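(* Let $M,Y,Q$ be $n\times n$ matrices with entries in $A^{\mathbb C}$ such that either (CSS case) (1) for all $l,j,r,p$: $[Y_{lj},M_{rp}]=\delta_{lp}Q_{rj}$, and (2) $M$ is a Manin matrix; or (TCSS case) (1') there is a central element $h\in A^{\mathbb C}$ such that for all $i,j,k,l$: $[M_{ij},Y_{kl}]=-h(\delta_{jk}\delta_{il}+\delta_{ik}\delta_{jl})$, and $Q=h\,\mathrm{Id}$; and (2') $M$ is a symmetric matrix with commuting entries. In both cases assume moreover: (3) entries in the same column of $Y$ commute: $[Y_{ak},Y_{bk}]=0$ for all $a,b,k$; (4) for any two entries $\alpha,\beta$ of the matrices $M,Y,Q$ (possibly of different matrices, possibly equal) $[\alpha,\bar\beta]=0$. Let $T$ be the $2n\times 2n$ block-diagonal matrix whose $m$-th diagonal $2\times2$ block is $$\begin{pmatrix} n-m+\tfrac14 & \tfrac{i}{4}\\ \tfrac{i}{4} & n-m-\tfrac14\end{pmatrix},\qquad m=1,\dots,n .$$ Then $${\det}^{\mathrm{col}}\big(M^{\mathbb R}Y^{\mathbb R}+Q^{\mathbb R}T\big)={\det}^{\mathrm{col}}\big(M^{\mathbb R}\big)\,{\det}^{\mathrm{col}}\big(Y^{\mathbb R}\big).$$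
   Context: Let $k$ be a field of characteristic different from $2$, $k[i]=k[t]/(t^2+1)$ with $i$ the class of $t$ (a formal imaginary unit; the case $k=\mathbb R$, $k[i]=\mathbb C$ is typical). $A$ is an associative unital (not necessarily commutative) $k$-algebra and $A^{\mathbb C}=A\otimes_k k[i]=A\oplus iA$. For $c=a+ib$ with $a,b\in A$ put $\mathrm{Re}(c)=a$, $\mathrm{Im}(c)=b$, $\bar c=a-ib$. For an $n\times m$ matrix $N$ over $A^{\mathbb C}$, $N^{\mathbb R}$ is the $2n\times 2m$ matrix over $A$ obtained by replacing each entry $N_{ij}$ by the $2\times2$ block $\begin{pmatrix}\mathrm{Re}(N_{ij})&\mathrm{Im}(N_{ij})\\-\mathrm{Im}(N_{ij})&\mathrm{Re}(N_{ij})\end{pmatrix}$. A matrix $M$ is a Manin matrix if entries in the same column commute and $[M_{pq},M_{kl}]=[M_{kq},M_{pl}]$ for all $p,q,k,l$. The column-determinant of an $N\times N$ matrix $M$ over a not necessarily commutative ring is ${\det}^{\mathrm{col}}M=\sum_{\sigma\in S_N}\mathrm{sgn}(\sigma)\,M_{\sigma(1)1}M_{\sigma(2)2}\cdots M_{\sigma(N)N}$ (factors ordered by column). $[a,b]=ab-ba$. *)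

theory Defs
  imports "Jordan_Normal_Form.Matrix" "HOL-Combinatorics.Permutations"
begin

locale unital_algebra = vector_space scale
  for scale :: "'k::field \<Rightarrow> 'a::ring_1 \<Rightarrow> 'a" +
  assumes scale_mult_left: "scale c x * y = scale c (x * y)"
    and scale_mult_right: "x * scale c y = scale c (x * y)"

text \<open>
  Adjoining a formal imaginary unit to a ring: \<open>Cx a b\<close> stands for \<open>a + i b\<close>, where \<open>i\<close> commutes
  with everything and \<open>i\<^sup>2 = -1\<close>. Over an algebra \<open>A\<close> this is \<open>A \<otimes>\<^sub>k k[i] = A \<oplus> iA\<close>; over the field
  \<open>k\<close> itself it is \<open>k[t]/(t\<^sup>2 + 1)\<close>, which need not be a field.
\<close>

datatype 'a cx = Cx (re: 'a) (im: 'a)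

instantiation cx :: (ring_1) ring_1
begin

definition zero_cx :: "'a cx" where "0 = Cx 0 0"
definition one_cx :: "'a cx" where "1 = Cx 1 0"
definition plus_cx :: "'a cx \<Rightarrow> 'a cx \<Rightarrow> 'a cx"
  where "x + y = Cx (re x + re y) (im x + im y)"
definition uminus_cx :: "'a cx \<Rightarrow> 'a cx" where "- x = Cx (- re x) (- im x)"
definition minus_cx :: "'a cx \<Rightarrow> 'a cx \<Rightarrow> 'a cx"
  where "x - y = Cx (re x - re y) (im x - im y)"
definition times_cx :: "'a cx \<Rightarrow> 'a cx \<Rightarrow> 'a cx"
  where "x * y = Cx (re x * re y - im x * im y) (re x * im y + im x * re y)"

instance
  by standard
    (simp_all add: zero_cx_def one_cx_def plus_cx_def uminus_cx_def minus_cx_def times_cx_def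
      algebra_simps)

end

definition cx_conj :: "'a::ring_1 cx \<Rightarrow> 'a cx"
  where "cx_conj z = Cx (re z) (- im z)"

definition cx_of :: "'a::ring_1 \<Rightarrow> 'a cx"
  where "cx_of a = Cx a 0"

text \<open>The structure map \<open>k[i] \<rightarrow> A \<otimes>\<^sub>k k[i]\<close>.\<close>

definition cx_scalar :: "('k::field \<Rightarrow> 'a::ring_1 \<Rightarrow> 'a) \<Rightarrow> 'k cx \<Rightarrow> 'a cx"
  where "cx_scalar scale c = Cx (scale (re c) 1) (scale (im c) 1)"

definition commutator :: "'a::ring \<Rightarrow> 'a \<Rightarrow> 'a"
  where "commutator a b = a * b - b * a"

definition manin_mat :: "'a::ring mat \<Rightarrow> bool"
  where "manin_mat M \<longleftrightarrow>
    (\<forall>p<dim_row M. \<forall>k<dim_row M. \<forall>q<dim_col M. commutator (M $$ (p,q)) (M $$ (k,q)) = 0) \<and>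
    (\<forall>p<dim_row M. \<forall>q<dim_col M. \<forall>k<dim_row M. \<forall>l<dim_col M.
       commutator (M $$ (p,q)) (M $$ (k,l)) = commutator (M $$ (k,q)) (M $$ (p,l)))"

text \<open>The factors of each product are ordered by column, from left to right.\<close>

definition det_col :: "'a::ring_1 mat \<Rightarrow> 'a"
  where "det_col M = (\<Sum>\<sigma> | \<sigma> permutes {0..<dim_col M}.
    of_int (sign \<sigma>) * prod_list (map (\<lambda>j. M $$ (\<sigma> j, j)) [0..<dim_col M]))"

text \<open>
  Indices start at \<open>0\<close>: row \<open>p\<close> of a matrix made of \<open>2 \<times> 2\<close> blocks lies in block row \<open>p div 2\<close>, and
  is the upper row of its block iff \<open>p\<close> is even; likewise for columns.
\<close>

definition decomplexify :: "'a::ring_1 cx mat \<Rightarrow> 'a mat"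
  where "decomplexify N = mat (2 * dim_row N) (2 * dim_col N) (\<lambda>(p,q).
    let z = N $$ (p div 2, q div 2) in
      if even p then (if even q then re z else im z)
      else (if even q then - im z else re z))"

text \<open>
  The block-diagonal correction matrix over \<open>k[i]\<close>. The block with \<open>0\<close>-based index \<open>b\<close> is the one
  with \<open>1\<close>-based index \<open>m = b + 1\<close>; \<open>Cx 0 (1/4)\<close> is \<open>i/4\<close>.
\<close>

definition correction_mat :: "nat \<Rightarrow> 'k::field cx mat"
  where "correction_mat n = mat (2 * n) (2 * n) (\<lambda>(p,q).
    if p div 2 \<noteq> q div 2 then 0
    else if p \<noteq> q then Cx 0 (1/4)
    else if even p then Cx (of_nat n - of_nat (p div 2 + 1) + 1/4) 0
    else Cx (of_nat n - of_nat (p div 2 + 1) - 1/4) 0)"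

end

theory Submission
  imports Defs
begin

text \<open>
  The identity is computed in a Grassmann algebra. If \<open>g\<^sub>0, g\<^sub>1, \<dots>\<close> anticommute and commute with the
  coefficients, then the product over the columns \<open>j\<close> of the elements \<open>\<Sum>\<^sub>p g\<^sub>p Z\<^sub>p\<^sub>j\<close> is the top monomial times
  the column-determinant of \<open>Z\<close>, with no commutativity assumption on \<open>Z\<close>.

  For \<open>C = M Y + Q diag(n - 1, \<dots>, 0)\<close> this gives the undecomplexified Capelli identity
  \<open>det C = det M det Y\<close> (\<open>capelli\<close>). Write \<open>m\<^sub>a\<close>, \<open>\<theta>\<^sub>j\<close> for the elements attached to the columns of
  \<open>M\<close> and \<open>Q\<close>, and \<open>\<eta>\<^sub>j = \<Sum>\<^sub>a m\<^sub>a Y\<^sub>a\<^sub>j\<close>. All that is used is that the \<open>m\<^sub>a\<close> anticommute among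
  themselves and with \<open>\<theta>\<^sub>j\<close>, and that \<open>\<Sum>\<^sub>a m\<^sub>a [Y\<^sub>a\<^sub>j, m\<^sub>b] = - \<theta>\<^sub>j m\<^sub>b\<close>; both kinds of hypotheses
  yield these relations. Moving \<open>Y\<^sub>a\<^sub>j\<close> to the right past \<open>k\<close> factors \<open>m\<^sub>b\<close> then costs \<open>- k \<theta>\<^sub>j\<close>, which
  the diagonal matrix compensates.

  For the decomplexified identity take \<open>2n\<close> variables \<open>e\<^sub>r\<close> and put \<open>\<psi>\<^sub>p = i e\<^sub>2\<^sub>p - e\<^sub>2\<^sub>p\<^sub>+\<^sub>1\<close>,
  \<open>\<phi>\<^sub>p = (e\<^sub>2\<^sub>p - i e\<^sub>2\<^sub>p\<^sub>+\<^sub>1) / 2\<close>, so that \<open>\<psi>\<^sub>p \<phi>\<^sub>p = e\<^sub>2\<^sub>p e\<^sub>2\<^sub>p\<^sub>+\<^sub>1\<close>. Let \<open>\<alpha>\<^sub>j\<close>, \<open>\<theta>\<^sub>j\<close> be the columns of \<open>C\<close>,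
  \<open>Q\<close> written with \<open>\<psi>\<close>, and \<open>\<beta>\<^sub>j\<close> the column of the conjugate of \<open>C\<close> written with \<open>\<phi>\<close>. The two columns
  of the left-hand matrix with block index \<open>j\<close> are
  \<open>\<beta>\<^sub>j - (i/2) (\<alpha>\<^sub>j + \<theta>\<^sub>j/2)\<close> and \<open>i \<beta>\<^sub>j - (1/2) (\<alpha>\<^sub>j - \<theta>\<^sub>j/2)\<close>. As \<open>\<beta>\<^sub>j\<close> anticommutes with \<open>\<alpha>\<^sub>j\<close> and
  \<open>\<theta>\<^sub>j\<close>, and as \<open>(\<alpha>\<^sub>j + \<theta>\<^sub>j/2) (\<alpha>\<^sub>j - \<theta>\<^sub>j/2) = 0\<close> (\<open>column_shift_product\<close>; this is what the quarters in
  the correction matrix are for), their product is \<open>\<alpha>\<^sub>j \<beta>\<^sub>j + i \<beta>\<^sub>j \<beta>\<^sub>j\<close>. In the product over all \<open>j\<close>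
  every term with a factor \<open>\<beta>\<^sub>j \<beta>\<^sub>j\<close> has more than \<open>n\<close> factors \<open>\<phi>\<close> and vanishes
  (\<open>prod_drop_excess\<close>). What remains is \<open>det C\<close> times its conjugate (\<open>column_det_doubled\<close>). With
  \<open>Q = 0\<close> the same computation gives \<open>det M\<^sup>\<real> = det M \<cdot> conj (det M)\<close> and likewise for \<open>Y\<close>, and the
  conjugate of \<open>det M\<close> commutes with \<open>det Y\<close>.
\<close>

section \<open>Products of anticommuting elements\<close>

lemma sum_antisym_eq_0:
  fixes f :: "nat \<Rightarrow> nat \<Rightarrow> 'r::ring_1"
  assumes "\<And>p q. p < n \<Longrightarrow> q < n \<Longrightarrow> f p q = - f q p" and "\<And>p. p < n \<Longrightarrow> f p p = 0"
  shows "(\<Sum>p<n. \<Sum>q<n. f p q) = 0"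
  using assms
proof (induction n)
  case (Suc n)
  have "(\<Sum>p<n. \<Sum>q<n. f p q) = 0"
    by (rule Suc.IH) (meson Suc.prems less_SucI)+
  moreover have "(\<Sum>q<n. f n q) = - (\<Sum>p<n. f p n)"
    unfolding sum_negf[symmetric] by (intro sum.cong refl Suc.prems(1)) auto
  ultimately show ?case using Suc.prems(2)[of n] by (simp add: sum.distrib)
qed simp

text \<open>
  The squares are required to vanish separately, so that nothing here depends on the invertibility
  of \<open>2\<close>.
\<close>

definition anticommuting :: "nat \<Rightarrow> (nat \<Rightarrow> 'r::ring_1) \<Rightarrow> bool"
  where "anticommuting n x \<longleftrightarrow>
    (\<forall>p<n. \<forall>q<n. x p * x q = - (x q * x p)) \<and> (\<forall>p<n. x p * x p = 0)"

lemma anticommuting_swap: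
  "anticommuting n x \<Longrightarrow> p < n \<Longrightarrow> q < n \<Longrightarrow> x p * x q = - (x q * x p)"
  unfolding anticommuting_def by blast

lemma anticommuting_square: "anticommuting n x \<Longrightarrow> p < n \<Longrightarrow> x p * x p = 0"
  unfolding anticommuting_def by blast

lemma anticommuting_sum_sym:
  fixes x :: "nat \<Rightarrow> 'r::ring_1"
  assumes x: "anticommuting n x" and c: "\<And>p q. p < n \<Longrightarrow> q < n \<Longrightarrow> c p q = c q p"
  shows "(\<Sum>p<n. \<Sum>q<n. x p * x q * c p q) = 0"
proof (rule sum_antisym_eq_0)
  fix p q assume pq: "p < n" "q < n"
  show "x p * x q * c p q = - (x q * x p * c q p)"
    by (simp only: anticommuting_swap[OF x pq] c[OF pq] mult_minus_left)
next
  show "x p * x p * c p p = 0" if "p < n" for p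
    using anticommuting_square[OF x that] by simp
qed

text \<open>A sign picked up when an element moves past a product.\<close>

lemma anticomm_prod_list:
  fixes x :: "'r::ring_1"
  assumes "\<And>z. z \<in> set zs \<Longrightarrow> x * z = - (z * x)"
  shows "x * prod_list zs = (- 1) ^ length zs * (prod_list zs * x)"
  using assms
proof (induction zs)
  case (Cons z zs)
  have c: "z * (- 1) ^ k = (- 1) ^ k * z" for k :: nat
    by (induction k) (simp_all add: algebra_simps)
  have "x * prod_list (z # zs) = (x * z) * prod_list zs" by (simp add: mult.assoc)
  also have "x * z = - (z * x)" using Cons.prems[of z] by simp
  also have "- (z * x) * prod_list zs = - (z * (x * prod_list zs))" by (simp add: mult.assoc)
  also have "x * prod_list zs = (- 1) ^ length zs * (prod_list zs * x)"
    by (rule Cons.IH) (rule Cons.prems, simp)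
  also have "z * ((- 1) ^ length zs * (prod_list zs * x))
      = (- 1) ^ length zs * (z * (prod_list zs * x))"
    by (metis c mult.assoc)
  finally show ?case by (simp add: mult.assoc)
qed simp

lemma anticommuting_swap_prod_list:
  fixes x :: "nat \<Rightarrow> 'r::ring_1"
  assumes x: "anticommuting n x" and "a < n" "b < n" "set zs \<subseteq> {..<n}"
  shows "x a * prod_list (map x zs) * x b = - (x b * prod_list (map x zs) * x a)"
proof -
  let ?P = "prod_list (map x zs)" let ?s = "(- 1 :: 'r) ^ length zs"
  have mv: "x c * ?P = ?s * (?P * x c)" if "c < n" for c
  proof -
    have "x c * z = - (z * x c)" if "z \<in> set (map x zs)" for z
      using that assms(4) anticommuting_swap[OF x \<open>c < n\<close>] by (metis imageE lessThan_iff list.set_map subsetD)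
    from anticomm_prod_list[of "map x zs", OF this] show ?thesis by simp
  qed
  have "x a * ?P * x b = ?s * ?P * (x a * x b)" "x b * ?P * x a = ?s * ?P * (x b * x a)"
    by (simp_all only: mv[OF assms(2)] mv[OF assms(3)] mult.assoc)
  moreover have "?s * ?P * (x a * x b) = - (?s * ?P * (x b * x a))"
    by (subst anticommuting_swap[OF x assms(2,3)]) simp
  ultimately show ?thesis by metis
qed

lemma anticommuting_prod_list_not_distinct:
  fixes x :: "nat \<Rightarrow> 'r::ring_1"
  assumes x: "anticommuting n x" and ps: "set ps \<subseteq> {..<n}" "\<not> distinct ps"
  shows "prod_list (map x ps) = 0"
proof -
  obtain us vs ws a where dec: "ps = us @ [a] @ vs @ [a] @ ws"
    using not_distinct_decomp[OF ps(2)] by blast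
  have a: "a < n" and vs: "set vs \<subseteq> {..<n}" using ps(1) dec by auto
  have mv: "x a * prod_list (map x vs) = (- 1) ^ length vs * (prod_list (map x vs) * x a)"
  proof -
    have "x a * z = - (z * x a)" if "z \<in> set (map x vs)" for z
      using that vs anticommuting_swap[OF x a] by (metis imageE lessThan_iff list.set_map subsetD)
    from anticomm_prod_list[of "map x vs", OF this] show ?thesis by simp
  qed
  have "x a * prod_list (map x vs) * x a = (- 1) ^ length vs * (prod_list (map x vs) * (x a * x a))"
    by (simp only: mv mult.assoc)
  hence z: "x a * prod_list (map x vs) * x a = 0" by (simp add: anticommuting_square[OF x a])
  have "prod_list (map x ps)
    = prod_list (map x us) * (x a * prod_list (map x vs) * x a) * prod_list (map x ws)"
    by (simp add: dec mult.assoc)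
  thus ?thesis using z by simp
qed

lemma anticommuting_prod_list_long:
  assumes "anticommuting n x" "set ps \<subseteq> {..<n}" "n < length ps"
  shows "prod_list (map x ps) = 0"
proof (rule anticommuting_prod_list_not_distinct[OF assms(1,2)])
  show "\<not> distinct ps"
    using assms(2,3) distinct_card[of ps] card_mono[of "{..<n}" "set ps"] by auto
qed

lemma anticommuting_prod_transpose_less:
  fixes x :: "nat \<Rightarrow> 'r::ring_1"
  assumes x: "anticommuting n x" and ab: "a < b" "b < n"
  shows "prod_list (map (\<lambda>j. x (Transposition.transpose a b j)) [0..<n]) = - prod_list (map x [0..<n])"
proof -
  let ?t = "Transposition.transpose a b"
  have l: "[0..<n] = [0..<a] @ [a] @ [Suc a..<b] @ [b] @ [Suc b..<n]"
  proof -
    have "[0..<n] = [0..<a] @ [a..<n]" using ab upt_add_eq_append[of 0 a "n - a"] by simp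
    also have "[a..<n] = a # [Suc a..<n]" using ab by (simp add: upt_conv_Cons)
    also have "[Suc a..<n] = [Suc a..<b] @ [b..<n]"
      using ab upt_add_eq_append[of "Suc a" b "n - b"] by simp
    also have "[b..<n] = b # [Suc b..<n]" using ab by (simp add: upt_conv_Cons)
    finally show ?thesis by simp
  qed
  have id: "map (\<lambda>j. x (?t j)) zs = map x zs" if "a \<notin> set zs" "b \<notin> set zs" for zs
    using that by (intro map_cong) (auto simp: Transposition.transpose_def)
  have m: "map (\<lambda>j. x (?t j)) [0..<a] = map x [0..<a]"
    "map (\<lambda>j. x (?t j)) [Suc a..<b] = map x [Suc a..<b]"
    "map (\<lambda>j. x (?t j)) [Suc b..<n] = map x [Suc b..<n]"
    using ab by (auto intro!: id)
  let ?A = "prod_list (map x [0..<a])" let ?C = "prod_list (map x [Suc b..<n])"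
  let ?B = "prod_list (map x [Suc a..<b])"
  have "prod_list (map (\<lambda>j. x (?t j)) [0..<n]) = ?A * (x b * ?B * x a) * ?C"
    unfolding l map_append m by (simp add: mult.assoc)
  also have "x b * ?B * x a = - (x a * ?B * x b)"
    using ab by (intro anticommuting_swap_prod_list[OF x]) auto
  also have "?A * - (x a * ?B * x b) * ?C = - prod_list (map x [0..<n])"
    unfolding l by (simp add: mult.assoc)
  finally show ?thesis .
qed

lemma anticommuting_prod_transpose:
  fixes x :: "nat \<Rightarrow> 'r::ring_1"
  assumes x: "anticommuting n x" and ab: "a < n" "b < n" "a \<noteq> b"
  shows "prod_list (map (\<lambda>j. x (Transposition.transpose a b j)) [0..<n]) = - prod_list (map x [0..<n])"
  using anticommuting_prod_transpose_less[OF x, of a b] anticommuting_prod_transpose_less[OF x, of b a] ab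
  by (metis linorder_less_linear transpose_commute)

lemma anticommuting_prod_permutes:
  fixes x :: "nat \<Rightarrow> 'r::ring_1"
  assumes "\<sigma> permutes {0..<n}" "anticommuting n x"
  shows "prod_list (map (\<lambda>j. x (\<sigma> j)) [0..<n]) = of_int (sign \<sigma>) * prod_list (map x [0..<n])"
  using assms(1) finite_atLeastLessThan assms(2)
proof (induction \<sigma> arbitrary: x rule: permutes_induct)
  case id
  thus ?case by simp
next
  case (swap a b p)
  let ?x = "\<lambda>j. x (Transposition.transpose a b j)"
  have t: "Transposition.transpose a b j < n" if "j < n" for j
    using that swap.hyps by (auto simp: Transposition.transpose_def)
  have x: "anticommuting n ?x"
    using t anticommuting_swap[OF swap.prems] anticommuting_square[OF swap.prems]
    unfolding anticommuting_def by blast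
  have sign: "sign (Transposition.transpose a b \<circ> p) = - sign p"
    using swap.hyps permutation_permutes[of p] 
    by (subst sign_compose) (auto simp: permutation_swap_id sign_swap_id intro: permutes_imp_permutation)
  have prod: "prod_list (map (\<lambda>j. x ((Transposition.transpose a b \<circ> p) j)) [0..<n])
      = of_int (sign p) * prod_list (map ?x [0..<n])"
    using swap.IH[OF x] by simp
  have "prod_list (map ?x [0..<n]) = - prod_list (map x [0..<n])"
    by (rule anticommuting_prod_transpose[OF swap.prems]) (use swap.hyps in auto)
  thus ?case unfolding prod sign by simp
qed

lemma prod_list_interleave:
  fixes a b :: "nat \<Rightarrow> 'r::ring_1"
  assumes "\<And>j k. j < n \<Longrightarrow> k < n \<Longrightarrow> a j * b k = - (b k * a j)"
  shows "prod_list (map (\<lambda>j. a j * b j) [0..<n])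
    = (- 1) ^ (n * (n - 1) div 2) * (prod_list (map a [0..<n]) * prod_list (map b [0..<n]))"
  using assms
proof (induction n)
  case (Suc n)
  let ?A = "prod_list (map a [0..<n])" let ?B = "prod_list (map b [0..<n])"
  let ?s = "(- 1 :: 'r) ^ n"
  have mv: "a n * ?B = ?s * (?B * a n)"
  proof -
    have "a n * z = - (z * a n)" if z: "z \<in> set (map b [0..<n])" for z
    proof -
      from z obtain k where "k < n" "z = b k" by auto
      thus ?thesis using Suc.prems[of n k] by simp
    qed
    from anticomm_prod_list[of "map b [0..<n]", OF this] show ?thesis by simp
  qed
  have "?B * a n = ?s * (?s * (?B * a n))"
    by (cases "even n") simp_all
  also have "?s * (?B * a n) = a n * ?B" by (rule mv[symmetric])
  finally have sw: "?B * a n = ?s * (a n * ?B)" .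
  have c: "?A * (?s * z) = ?s * (?A * z)" for z
    by (cases "even n") simp_all
  have e: "Suc n * (Suc n - 1) div 2 = n * (n - 1) div 2 + n"
  proof -
    have "Suc n * (Suc n - 1) = n * (n - 1) + n * 2" by (cases n) (auto simp: algebra_simps)
    thus ?thesis by (simp only: div_mult_self1[OF zero_neq_numeral[symmetric]] add.commute)
  qed
  have ih: "prod_list (map (\<lambda>j. a j * b j) [0..<n]) = (- 1) ^ (n * (n - 1) div 2) * (?A * ?B)"
    by (rule Suc.IH) (meson Suc.prems less_SucI)
  have "prod_list (map (\<lambda>j. a j * b j) [0..<Suc n])
      = prod_list (map (\<lambda>j. a j * b j) [0..<n]) * (a n * b n)"
    by simp
  also have "\<dots> = (- 1) ^ (n * (n - 1) div 2) * (?A * ((?B * a n) * b n))"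
    by (simp only: ih mult.assoc)
  also have "?A * ((?B * a n) * b n) = ?s * (?A * a n * (?B * b n))"
    unfolding sw by (simp only: mult.assoc c)
  finally show ?case unfolding e by (simp add: power_add mult.assoc)
qed simp

section \<open>Normal ordering and the Capelli identity\<close>

text \<open>
  The sum over all words \<open>a\<^sub>1, \<dots>, a\<^sub>s\<close> in \<open>{..<n}\<close> of
  \<open>m\<^bsub>a\<^sub>1\<^esub> \<cdots> m\<^bsub>a\<^sub>s\<^esub> P y\<^bsub>a\<^sub>1 j\<^sub>1\<^esub> \<cdots> y\<^bsub>a\<^sub>s j\<^sub>s\<^esub>\<close>, where \<open>js = [j\<^sub>1, \<dots>, j\<^sub>s]\<close>: all \<open>m\<close> stand to
  the left of all \<open>y\<close>. The slot \<open>P\<close> in the middle is what makes the recursion work.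
\<close>

fun normal_ordered :: "nat \<Rightarrow> (nat \<Rightarrow> 'r::ring_1) \<Rightarrow> (nat \<Rightarrow> nat \<Rightarrow> 'r) \<Rightarrow> nat list \<Rightarrow> 'r \<Rightarrow> 'r"
  where
    "normal_ordered n m y [] P = P"
  | "normal_ordered n m y (j # js) P = (\<Sum>a<n. m a * normal_ordered n m y js (P * y a j))"

lemma words_Suc:
  "{as. set as \<subseteq> {..<n} \<and> length as = Suc k}
    = (\<lambda>(a, as). a # as) ` ({..<n::nat} \<times> {as. set as \<subseteq> {..<n} \<and> length as = k})"
  by (auto simp: length_Suc_conv image_iff)

lemma normal_ordered_eq_sum:
  "normal_ordered n m y js P = (\<Sum>as | set as \<subseteq> {..<n} \<and> length as = length js.
      prod_list (map m as) * P * prod_list (map2 y as js))"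
proof (induction js arbitrary: P)
  case Nil
  have "{as. set as \<subseteq> {..<n} \<and> length as = length ([] :: nat list)} = {[]}" by auto
  thus ?case by simp
next
  case (Cons j js)
  let ?W = "{as. set as \<subseteq> {..<n} \<and> length as = length js}"
  have "normal_ordered n m y (j # js) P
      = (\<Sum>a<n. \<Sum>as\<in>?W. m a * (prod_list (map m as) * (P * y a j) * prod_list (map2 y as js)))"
    using Cons by (simp add: sum_distrib_left)
  also have "\<dots> = (\<Sum>(a, as)\<in>{..<n} \<times> ?W.
      prod_list (map m (a # as)) * P * prod_list (map2 y (a # as) (j # js)))"
    by (simp add: sum.cartesian_product mult.assoc)
  also have "\<dots> = (\<Sum>as\<in>(\<lambda>(a, as). a # as) ` ({..<n} \<times> ?W).
      prod_list (map m as) * P * prod_list (map2 y as (j # js)))"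
    by (subst sum.reindex) (auto simp: inj_on_def intro!: sum.cong)
  finally show ?case by (simp add: words_Suc)
qed

lemma bij_betw_permutes_words:
  "bij_betw (\<lambda>\<sigma>. map \<sigma> [0..<n]) {\<sigma>. \<sigma> permutes {0..<n}}
    {as. set as \<subseteq> {..<n} \<and> length as = n \<and> distinct as}"
proof (rule bij_betw_imageI)
  show "inj_on (\<lambda>\<sigma>. map \<sigma> [0..<n]) {\<sigma>. \<sigma> permutes {0..<n}}"
  proof (rule inj_onI, rule ext)
    fix \<sigma> \<tau> :: "nat \<Rightarrow> nat" and j
    assume a: "\<sigma> \<in> {\<sigma>. \<sigma> permutes {0..<n}}" "\<tau> \<in> {\<sigma>. \<sigma> permutes {0..<n}}"
      "map \<sigma> [0..<n] = map \<tau> [0..<n]"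
    show "\<sigma> j = \<tau> j"
    proof (cases "j < n")
      case True
      thus ?thesis using arg_cong[OF a(3), of "\<lambda>l. l ! j"] by simp
    next
      case False
      thus ?thesis using a(1,2) by (simp add: permutes_not_in)
    qed
  qed
next
  show "(\<lambda>\<sigma>. map \<sigma> [0..<n]) ` {\<sigma>. \<sigma> permutes {0..<n}}
      = {as. set as \<subseteq> {..<n} \<and> length as = n \<and> distinct as}" (is "?L = ?R")
  proof
    show "?L \<subseteq> ?R"
    proof (rule image_subsetI)
      fix \<sigma> assume "\<sigma> \<in> {\<sigma>. \<sigma> permutes {0..<n}}"
      hence s: "\<sigma> permutes {0..<n}" by simp
      have "set (map \<sigma> [0..<n]) \<subseteq> {..<n}"
        using permutes_image[OF s] by (simp add: atLeast0LessThan)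
      moreover have "distinct (map \<sigma> [0..<n])"
        using permutes_inj_on[OF s] by (simp add: distinct_map)
      ultimately show "map \<sigma> [0..<n] \<in> ?R" by simp
    qed
    show "?R \<subseteq> ?L"
    proof
      fix as assume as: "as \<in> ?R"
      define \<sigma> where "\<sigma> j = (if j < n then as ! j else j)" for j
      have "bij_betw \<sigma> {0..<n} {0..<n}"
      proof -
        have "bij_betw ((!) as) {..<n} (set as)" using as by (intro bij_betw_nth) auto
        moreover have "set as = {..<n}"
          using as distinct_card[of as] by (intro card_subset_eq) auto
        ultimately have "bij_betw ((!) as) {0..<n} {0..<n}" by (simp add: atLeast0LessThan)
        moreover have "bij_betw \<sigma> {0..<n} {0..<n} = bij_betw ((!) as) {0..<n} {0..<n}"
          by (rule bij_betw_cong) (simp add: \<sigma>_def)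
        ultimately show ?thesis by blast
      qed
      hence "\<sigma> permutes {0..<n}" by (intro bij_imp_permutes) (auto simp: \<sigma>_def)
      moreover have "as = map \<sigma> [0..<n]"
        using as by (intro nth_equalityI) (auto simp: \<sigma>_def)
      ultimately show "as \<in> ?L" by blast
    qed
  qed
qed

text \<open>The column-determinant of a family of entries, without the detour through matrices.\<close>

definition column_det :: "nat \<Rightarrow> (nat \<Rightarrow> nat \<Rightarrow> 'r::ring_1) \<Rightarrow> 'r"
  where "column_det n y = (\<Sum>\<sigma> | \<sigma> permutes {0..<n}.
    of_int (sign \<sigma>) * prod_list (map (\<lambda>j. y (\<sigma> j) j) [0..<n]))"

text \<open>Words with a repeated letter drop out, and the others are the permutations.\<close>

lemma normal_ordered_eq_column_det:
  fixes m :: "nat \<Rightarrow> 'r::ring_1"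
  assumes m: "anticommuting n m"
  shows "normal_ordered n m y [0..<n] 1 = prod_list (map m [0..<n]) * column_det n y"
proof -
  let ?W = "{as. set as \<subseteq> {..<n} \<and> length as = n}"
  let ?D = "{as. set as \<subseteq> {..<n} \<and> length as = n \<and> distinct as}"
  have z: "map2 y (map \<sigma> [0..<n]) [0..<n] = map (\<lambda>j. y (\<sigma> j) j) [0..<n]" for \<sigma>
    by (intro nth_equalityI) auto
  have "normal_ordered n m y [0..<n] 1
      = (\<Sum>as\<in>?W. prod_list (map m as) * prod_list (map2 y as [0..<n]))"
    by (simp add: normal_ordered_eq_sum)
  also have "\<dots> = (\<Sum>as\<in>?D. prod_list (map m as) * prod_list (map2 y as [0..<n]))"
    using anticommuting_prod_list_not_distinct[OF m]
    by (intro sum.mono_neutral_right finite_lists_length_eq) auto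
  also have "\<dots> = (\<Sum>\<sigma> | \<sigma> permutes {0..<n}. prod_list (map m (map \<sigma> [0..<n]))
      * prod_list (map2 y (map \<sigma> [0..<n]) [0..<n]))"
    using sum.reindex_bij_betw[OF bij_betw_permutes_words[of n],
        of "\<lambda>as. prod_list (map m as) * prod_list (map2 y as [0..<n])"] by simp
  also have "\<dots> = (\<Sum>\<sigma> | \<sigma> permutes {0..<n}. prod_list (map m [0..<n])
      * (of_int (sign \<sigma>) * prod_list (map (\<lambda>j. y (\<sigma> j) j) [0..<n])))"
  proof (rule sum.cong)
    fix \<sigma> assume "\<sigma> \<in> {\<sigma>. \<sigma> permutes {0..<n}}"
    hence "prod_list (map m (map \<sigma> [0..<n])) = of_int (sign \<sigma>) * prod_list (map m [0..<n])"
      using anticommuting_prod_permutes[OF _ m] by (simp add: comp_def)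
    also have "\<dots> = prod_list (map m [0..<n]) * of_int (sign \<sigma>)"
      by (simp add: sign_def)
    finally show "prod_list (map m (map \<sigma> [0..<n])) * prod_list (map2 y (map \<sigma> [0..<n]) [0..<n])
      = prod_list (map m [0..<n]) * (of_int (sign \<sigma>) * prod_list (map (\<lambda>j. y (\<sigma> j) j) [0..<n]))"
      unfolding z by (simp add: mult.assoc)
  qed simp
  finally show ?thesis by (simp add: column_det_def sum_distrib_left)
qed

text \<open>
  Here \<open>m a\<close> and \<open>\<theta> j\<close> stand for the Grassmann elements attached to the columns of \<open>M\<close> and \<open>Q\<close>, and
  \<open>y a j\<close> for the entries of \<open>Y\<close>.
\<close>

locale capelli_system =
  fixes n :: nat and m :: "nat \<Rightarrow> 'r::ring_1" and y :: "nat \<Rightarrow> nat \<Rightarrow> 'r" and \<theta> :: "nat \<Rightarrow> 'r"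
  assumes m_anticomm: "anticommuting n m"
    and contraction: "\<And>j b. j < n \<Longrightarrow> b < n \<Longrightarrow>
      (\<Sum>a<n. m a * (y a j * m b - m b * y a j)) = - (\<theta> j * m b)"
    and \<theta>_m: "\<And>j b. j < n \<Longrightarrow> b < n \<Longrightarrow> \<theta> j * m b = - (m b * \<theta> j)"
begin

text \<open>The element attached to column \<open>j\<close> of \<open>M Y\<close>.\<close>

definition \<eta> :: "nat \<Rightarrow> 'r" where "\<eta> j = (\<Sum>a<n. m a * y a j)"

lemma contraction_mult:
  assumes "j < n" "b < n"
  shows "\<eta> j * m b = (\<Sum>a<n. m a * m b * y a j) - \<theta> j * m b"
  using contraction[OF assms]
  by (simp add: \<eta>_def sum_distrib_right right_diff_distrib sum_subtractf mult.assoc algebra_simps)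

text \<open>
  Multiplication by \<open>\<eta> j\<close> prepends the column \<open>j\<close> to a normally ordered expression, up to one term
  \<open>- \<theta> j\<close> for each \<open>m\<close> that \<open>y a j\<close> has to pass.
\<close>

lemma \<eta>_normal_ordered:
  assumes "j < n" "set js \<subseteq> {..<n}"
  shows "\<eta> j * normal_ordered n m y js P
    = (\<Sum>a<n. m a * normal_ordered n m y js (y a j * P))
      - of_nat (length js) * \<theta> j * normal_ordered n m y js P"
  using assms(2)
proof (induction js arbitrary: P)
  case Nil
  thus ?case by (simp add: \<eta>_def sum_distrib_right mult.assoc)
next
  case (Cons l js)
  let ?N = "normal_ordered n m y js"
  have step: "\<eta> j * (m b * ?N R)
      = (\<Sum>a<n. m a * (m b * ?N (y a j * R))) - of_nat (Suc (length js)) * \<theta> j * (m b * ?N R)"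
    if b: "b < n" for b R
  proof -
    have sw: "m a * m b = - (m b * m a)" if "a < n" for a
      by (rule anticommuting_swap[OF m_anticomm that b])
    have t: "m b * (of_nat k * \<theta> j * X) = - (of_nat k * \<theta> j * (m b * X))" for k :: nat and X
    proof -
      have "m b * (of_nat k * \<theta> j * X) = of_nat k * ((m b * \<theta> j) * X)"
        by (metis mult.assoc mult_of_nat_commute)
      also have "m b * \<theta> j = - (\<theta> j * m b)" using \<theta>_m[OF assms(1) b] by simp
      finally show ?thesis by (simp add: mult.assoc)
    qed
    have "(\<Sum>a<n. m a * m b * y a j) = - (m b * \<eta> j)"
      unfolding \<eta>_def sum_distrib_left sum_negf[symmetric]
      by (intro sum.cong) (simp_all add: sw mult.assoc)
    hence "\<eta> j * m b = - (m b * \<eta> j) - \<theta> j * m b"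
      using contraction_mult[OF assms(1) b] by simp
    hence "\<eta> j * (m b * ?N R) = - (m b * (\<eta> j * ?N R)) - \<theta> j * (m b * ?N R)"
      by (simp add: mult.assoc[symmetric] left_diff_distrib)
    also have "\<eta> j * ?N R = (\<Sum>a<n. m a * ?N (y a j * R)) - of_nat (length js) * \<theta> j * ?N R"
      using Cons by simp
    also have "- (m b * \<dots>) = (\<Sum>a<n. m a * (m b * ?N (y a j * R)))
        - of_nat (length js) * \<theta> j * (m b * ?N R)"
    proof -
      have "- (m b * (\<Sum>a<n. m a * ?N (y a j * R))) = (\<Sum>a<n. m a * (m b * ?N (y a j * R)))"
        unfolding sum_distrib_left sum_negf[symmetric]
        by (intro sum.cong) (simp_all add: sw mult.assoc[symmetric])
      thus ?thesis by (simp only: right_diff_distrib t) simp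
    qed
    finally show ?thesis by (simp add: algebra_simps)
  qed
  have "\<eta> j * normal_ordered n m y (l # js) P
      = (\<Sum>b<n. (\<Sum>a<n. m a * (m b * ?N (y a j * (P * y b l))))
          - of_nat (Suc (length js)) * \<theta> j * (m b * ?N (P * y b l)))"
    by (simp add: sum_distrib_left step del: of_nat_Suc)
  also have "\<dots> = (\<Sum>b<n. \<Sum>a<n. m a * (m b * ?N (y a j * (P * y b l))))
      - of_nat (Suc (length js)) * \<theta> j * (\<Sum>b<n. m b * ?N (P * y b l))"
    by (simp add: sum_subtractf sum_distrib_left del: of_nat_Suc)
  also have "(\<Sum>b<n. \<Sum>a<n. m a * (m b * ?N (y a j * (P * y b l))))
      = (\<Sum>a<n. \<Sum>b<n. m a * (m b * ?N (y a j * (P * y b l))))"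
    by (rule sum.swap)
  finally show ?case by (simp add: sum_distrib_left mult.assoc)
qed

lemma prod_eq_normal_ordered:
  assumes "k \<le> n"
  shows "prod_list (map (\<lambda>j. \<eta> j + of_nat (n - Suc j) * \<theta> j) [k..<n])
    = normal_ordered n m y [k..<n] 1"
  using assms
proof (induction k rule: inc_induct)
  case (step k)
  let ?N = "normal_ordered n m y [Suc k..<n]"
  have "[k..<n] = k # [Suc k..<n]" using step.hyps by (simp add: upt_conv_Cons)
  moreover have "(\<eta> k + of_nat (n - Suc k) * \<theta> k) * ?N 1 = (\<Sum>a<n. m a * ?N (y a k))"
  proof -
    have "set [Suc k..<n] \<subseteq> {..<n}" by auto
    thus ?thesis using \<eta>_normal_ordered[of k "[Suc k..<n]" 1] step.hyps
      by (simp add: distrib_right del: of_nat_diff)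
  qed
  ultimately show ?case using step.IH by simp
qed simp

lemma capelli:
  "prod_list (map (\<lambda>j. \<eta> j + of_nat (n - Suc j) * \<theta> j) [0..<n])
    = prod_list (map m [0..<n]) * column_det n y"
  using prod_eq_normal_ordered[of 0] normal_ordered_eq_column_det[OF m_anticomm] by simp

text \<open>
  Both \<open>\<eta> j * \<eta> j\<close> and \<open>\<eta> j * \<theta> j\<close> equal \<open>- (\<theta> j * \<eta> j)\<close>, so two multiples of \<open>\<theta> j\<close> whose
  coefficients differ by \<open>1\<close> cancel the failure of \<open>\<eta> j\<close> to square to zero.
\<close>

lemma column_shift_product:
  assumes j: "j < n"
    and y: "\<And>a b. a < n \<Longrightarrow> b < n \<Longrightarrow> y a j * y b j = y b j * y a j"
    and y_\<theta>: "\<And>a. a < n \<Longrightarrow> y a j * \<theta> j = \<theta> j * y a j"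
    and \<theta>_sq: "\<theta> j * \<theta> j = 0"
    and c: "c * \<eta> j = \<eta> j * c" "c * \<theta> j = \<theta> j * c" "d = c + 1"
  shows "(\<eta> j + d * \<theta> j) * (\<eta> j + c * \<theta> j) = 0"
proof -
  have "\<eta> j * \<eta> j = (\<Sum>b<n. (\<eta> j * m b) * y b j)"
    by (simp add: \<eta>_def[of j] sum_distrib_left mult.assoc)
  also have "\<dots> = (\<Sum>b<n. \<Sum>a<n. m a * m b * y a j * y b j) - \<theta> j * \<eta> j"
  proof -
    have "(\<Sum>b<n. (\<eta> j * m b) * y b j)
        = (\<Sum>b<n. ((\<Sum>a<n. m a * m b * y a j) - \<theta> j * m b) * y b j)"
      by (intro sum.cong refl) (simp only: contraction_mult[OF j] lessThan_iff)
    thus ?thesis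
      by (simp add: left_diff_distrib sum_subtractf sum_distrib_right
          sum_distrib_left \<eta>_def[of j] mult.assoc)
  qed
  also have "(\<Sum>b<n. \<Sum>a<n. m a * m b * y a j * y b j)
      = (\<Sum>a<n. \<Sum>b<n. m a * m b * (y a j * y b j))"
    by (subst sum.swap) (simp add: mult.assoc)
  also have "\<dots> = 0" by (rule anticommuting_sum_sym[OF m_anticomm]) (rule y)
  finally have sq: "\<eta> j * \<eta> j = - (\<theta> j * \<eta> j)" by simp
  have "\<eta> j * \<theta> j = (\<Sum>a<n. (m a * \<theta> j) * y a j)"
    by (simp add: \<eta>_def sum_distrib_right y_\<theta> mult.assoc)
  also have "\<dots> = - (\<theta> j * \<eta> j)"
    unfolding \<eta>_def sum_distrib_left sum_negf[symmetric]
    by (intro sum.cong) (simp_all add: \<theta>_m[OF j] mult.assoc[symmetric])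
  finally have sw: "\<eta> j * \<theta> j = - (\<theta> j * \<eta> j)" .
  have "\<eta> j * (c * \<theta> j) = c * (\<eta> j * \<theta> j)" "d * \<theta> j * (c * \<theta> j) = d * c * (\<theta> j * \<theta> j)"
    by (metis c(1,2) mult.assoc)+
  hence "(\<eta> j + d * \<theta> j) * (\<eta> j + c * \<theta> j)
      = \<eta> j * \<eta> j + c * (\<eta> j * \<theta> j) + d * (\<theta> j * \<eta> j) + d * c * (\<theta> j * \<theta> j)"
    by (simp only: distrib_left distrib_right) (simp add: mult.assoc)
  also have "\<dots> = 0" by (simp add: sq sw \<theta>_sq c(3) distrib_right)
  finally show ?thesis .
qed

end

section \<open>Grassmann variables over a noncommutative ring\<close>

lemma commute_prod_list:
  fixes x :: "'r::ring_1"
  assumes "\<And>z. z \<in> set zs \<Longrightarrow> x * z = z * x"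
  shows "x * prod_list zs = prod_list zs * x"
  using assms
proof (induction zs)
  case (Cons z zs)
  have "x * prod_list (z # zs) = (x * z) * prod_list zs" by (simp add: mult.assoc)
  also have "x * z = z * x" using Cons.prems[of z] by simp
  also have "z * x * prod_list zs = z * (x * prod_list zs)" by (simp add: mult.assoc)
  also have "x * prod_list zs = prod_list zs * x"
    by (rule Cons.IH) (rule Cons.prems, simp)
  finally show ?case by (simp add: mult.assoc)
qed simp

lemma commute_column_det:
  fixes x :: "'r::ring_1"
  assumes "\<And>p j. p < n \<Longrightarrow> j < n \<Longrightarrow> x * Z p j = Z p j * x"
  shows "x * column_det n Z = column_det n Z * x"
  unfolding column_det_def sum_distrib_left sum_distrib_right
proof (rule sum.cong[OF refl])
  fix \<sigma> assume "\<sigma> \<in> {\<sigma>. \<sigma> permutes {0..<n}}"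
  hence s: "\<sigma> permutes {0..<n}" by simp
  have "x * prod_list (map (\<lambda>j. Z (\<sigma> j) j) [0..<n]) = prod_list (map (\<lambda>j. Z (\<sigma> j) j) [0..<n]) * x"
  proof (rule commute_prod_list)
    fix z assume "z \<in> set (map (\<lambda>j. Z (\<sigma> j) j) [0..<n])"
    then obtain j where j: "j < n" "z = Z (\<sigma> j) j" by auto
    have "\<sigma> j < n" using permutes_in_image[OF s, of j] j(1) by simp
    thus "x * z = z * x" unfolding j(2) by (rule assms) (rule j(1))
  qed
  thus "x * (of_int (sign \<sigma>) * prod_list (map (\<lambda>j. Z (\<sigma> j) j) [0..<n]))
      = of_int (sign \<sigma>) * prod_list (map (\<lambda>j. Z (\<sigma> j) j) [0..<n]) * x"
    by (cases \<sigma> rule: sign_cases) simp_all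
qed

lemma ring_hom_column_det:
  fixes L :: "'b::ring_1 \<Rightarrow> 'r::ring_1"
  assumes add: "\<And>a b. L (a + b) = L a + L b" and mult: "\<And>a b. L (a * b) = L a * L b" and one: "L 1 = 1"
  shows "L (column_det n Z) = column_det n (\<lambda>p j. L (Z p j))"
proof -
  have zero: "L 0 = 0" using add[of 0 0] by simp
  have minus: "L (- a) = - L a" for a using add[of a "- a"] zero by (simp add: eq_neg_iff_add_eq_0 add.commute)
  have sum: "L (sum f A) = (\<Sum>a\<in>A. L (f a))" for f and A :: "(nat \<Rightarrow> nat) set"
    by (induction A rule: infinite_finite_induct) (simp_all add: zero add)
  have prod: "L (prod_list zs) = prod_list (map L zs)" for zs
    by (induction zs) (simp_all add: one mult)
  have "L (of_int (sign \<sigma>) * z) = of_int (sign \<sigma>) * L z" for \<sigma> :: "nat \<Rightarrow> nat" and z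
    by (cases \<sigma> rule: sign_cases) (simp_all add: minus)
  thus ?thesis by (simp add: column_det_def sum prod comp_def)
qed

text \<open>
  Variables \<open>g\<^sub>0, \<dots>, g\<^sub>n\<^sub>-\<^sub>1\<close> that anticommute with each other and commute with a copy \<open>L\<close> of the
  coefficient ring.
\<close>

locale grassmann =
  fixes L :: "'b::ring_1 \<Rightarrow> 'r::ring_1" and n :: nat and g :: "nat \<Rightarrow> 'r"
  assumes L_add: "L (a + b) = L a + L b"
    and L_mult: "L (a * b) = L a * L b"
    and L_one: "L 1 = 1"
    and g_L: "p < n \<Longrightarrow> g p * L a = L a * g p"
    and g_anticomm: "anticommuting n g"
begin

lemma L_zero: "L 0 = 0"
  using L_add[of 0 0] by simp

lemma L_minus: "L (- a) = - L a"
  using L_add[of a "- a"] L_zero by (simp add: eq_neg_iff_add_eq_0 add.commute)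

lemma L_diff: "L (a - b) = L a - L b"
  using L_add[of a "- b"] by (simp add: L_minus)

lemma L_of_nat: "L (of_nat k) = of_nat k"
  by (induction k) (simp_all add: L_zero L_one L_add)

text \<open>The element attached to a column of coefficients.\<close>

definition vec :: "(nat \<Rightarrow> 'b) \<Rightarrow> 'r"
  where "vec X = (\<Sum>p<n. g p * L (X p))"

lemma vec_cong: "(\<And>p. p < n \<Longrightarrow> X p = Z p) \<Longrightarrow> vec X = vec Z"
  by (simp add: vec_def)

lemma vec_add: "vec (\<lambda>p. X p + Z p) = vec X + vec Z"
  by (simp add: vec_def L_add distrib_left sum.distrib)

lemma vec_diff: "vec (\<lambda>p. X p - Z p) = vec X - vec Z"
  by (simp add: vec_def L_diff right_diff_distrib sum_subtractf)

lemma vec_zero: "vec (\<lambda>p. 0) = 0"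
  by (simp add: vec_def L_zero)

lemma vec_sum: "vec (\<lambda>p. \<Sum>a<k. X a p) = (\<Sum>a<(k::nat). vec (X a))"
  by (induction k) (simp_all add: vec_add vec_zero)

lemma vec_mult_L: "vec X * L a = vec (\<lambda>p. X p * a)"
  by (simp add: vec_def sum_distrib_right L_mult mult.assoc)

lemma L_mult_vec: "L a * vec X = vec (\<lambda>p. a * X p)"
  unfolding vec_def sum_distrib_left
  by (intro sum.cong refl) (metis L_mult g_L lessThan_iff mult.assoc)

lemma vec_unit: "j < n \<Longrightarrow> vec (\<lambda>p. if p = j then a else 0) = g j * L a"
  by (simp add: vec_def if_distrib[of L] if_distrib[of "times _"] L_zero cong: if_cong)

lemma vec_mult_vec: "vec X * vec Z = (\<Sum>p<n. \<Sum>q<n. g p * g q * L (X p * Z q))"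
proof -
  have "vec X * vec Z = (\<Sum>p<n. \<Sum>q<n. (g p * L (X p)) * (g q * L (Z q)))"
    by (simp add: vec_def sum_product)
  also have "\<dots> = (\<Sum>p<n. \<Sum>q<n. g p * g q * L (X p * Z q))"
  proof (intro sum.cong refl)
    fix p q assume "q \<in> {..<n}"
    hence "L (X p) * g q = g q * L (X p)" using g_L[of q] by simp
    hence "g p * (L (X p) * g q) * L (Z q) = g p * (g q * L (X p)) * L (Z q)" by simp
    thus "(g p * L (X p)) * (g q * L (Z q)) = g p * g q * L (X p * Z q)"
      by (simp add: L_mult mult.assoc)
  qed
  finally show ?thesis .
qed

lemma vec_anticomm_if_symmetric:
  assumes "\<And>p q. p < n \<Longrightarrow> q < n \<Longrightarrow> X p * Z q + Z p * X q = X q * Z p + Z q * X p"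
  shows "vec X * vec Z = - (vec Z * vec X)"
proof -
  have "vec X * vec Z + vec Z * vec X = (\<Sum>p<n. \<Sum>q<n. g p * g q * L (X p * Z q + Z p * X q))"
    by (simp add: vec_mult_vec L_add distrib_left sum.distrib)
  also have "\<dots> = 0"
    by (rule anticommuting_sum_sym[OF g_anticomm]) (simp only: assms)
  finally show ?thesis by (simp add: eq_neg_iff_add_eq_0)
qed

lemma vec_anticomm:
  assumes "\<And>p q. p < n \<Longrightarrow> q < n \<Longrightarrow> X p * Z q = Z q * X p"
  shows "vec X * vec Z = - (vec Z * vec X)"
proof (rule vec_anticomm_if_symmetric)
  fix p q assume pq: "p < n" "q < n"
  show "X p * Z q + Z p * X q = X q * Z p + Z q * X p"
    by (simp only: assms[OF pq] assms[OF pq(2,1)] add.commute)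
qed

lemma vec_square:
  assumes "\<And>p q. p < n \<Longrightarrow> q < n \<Longrightarrow> X p * X q = X q * X p"
  shows "vec X * vec X = 0"
  unfolding vec_mult_vec
  by (rule anticommuting_sum_sym[OF g_anticomm]) (simp only: assms)

lemma L_column_det: "L (column_det n Z) = column_det n (\<lambda>p j. L (Z p j))"
  by (rule ring_hom_column_det) (fact L_add L_mult L_one)+

text \<open>The Capelli identity with \<open>\<theta> = 0\<close>, the variables themselves taking the place of \<open>m\<close>.\<close>

lemma prod_vec:
  "prod_list (map (\<lambda>j. vec (\<lambda>p. X p j)) [0..<n]) = prod_list (map g [0..<n]) * L (column_det n X)"
proof -
  interpret capelli_system n g "\<lambda>a j. L (X a j)" "\<lambda>_. 0"
    by unfold_locales (simp_all add: g_anticomm g_L)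
  show ?thesis
    using capelli by (simp add: \<eta>_def vec_def L_column_det)
qed

end

section \<open>The two kinds of Capelli systems\<close>

text \<open>
  The entrywise commutation relations between \<open>M\<close>, \<open>Y\<close> and \<open>Q\<close>. In the first kind \<open>M\<close> is a Manin
  matrix; in the second kind \<open>M\<close> is symmetric with commuting entries and \<open>Q = h Id\<close>.
\<close>

definition manin_relations ::
    "nat \<Rightarrow> (nat \<Rightarrow> nat \<Rightarrow> 'b::ring_1) \<Rightarrow> (nat \<Rightarrow> nat \<Rightarrow> 'b) \<Rightarrow> (nat \<Rightarrow> nat \<Rightarrow> 'b) \<Rightarrow> bool"
  where "manin_relations n M Y Q \<longleftrightarrow>
    (\<forall>l<n. \<forall>j<n. \<forall>r<n. \<forall>p<n. Y l j * M r p = M r p * Y l j + (if l = p then Q r j else 0)) \<and>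
    (\<forall>p<n. \<forall>q<n. \<forall>a<n. M p a * M q a = M q a * M p a) \<and>
    (\<forall>p<n. \<forall>q<n. \<forall>a<n. \<forall>b<n. M p a * M q b - M q b * M p a = M q a * M p b - M p b * M q a)"

lemma manin_relationsD:
  assumes "manin_relations n M Y Q"
  shows manin_relations_commutator: "l < n \<Longrightarrow> j < n \<Longrightarrow> r < n \<Longrightarrow> p < n \<Longrightarrow>
      Y l j * M r p = M r p * Y l j + (if l = p then Q r j else 0)"
    and manin_relations_column: "p < n \<Longrightarrow> q < n \<Longrightarrow> a < n \<Longrightarrow> M p a * M q a = M q a * M p a"
    and manin_relations_cross: "p < n \<Longrightarrow> q < n \<Longrightarrow> a < n \<Longrightarrow> b < n \<Longrightarrow>
      M p a * M q b - M q b * M p a = M q a * M p b - M p b * M q a"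
  using assms unfolding manin_relations_def by meson+

definition symmetric_relations ::
    "nat \<Rightarrow> 'b \<Rightarrow> (nat \<Rightarrow> nat \<Rightarrow> 'b::ring_1) \<Rightarrow> (nat \<Rightarrow> nat \<Rightarrow> 'b) \<Rightarrow> (nat \<Rightarrow> nat \<Rightarrow> 'b) \<Rightarrow> bool"
  where "symmetric_relations n h M Y Q \<longleftrightarrow>
    (\<forall>x. h * x = x * h) \<and>
    (\<forall>l<n. \<forall>j<n. \<forall>r<n. \<forall>p<n. Y l j * M r p =
       M r p * Y l j + ((if r = j then if l = p then h else 0 else 0) + (if r = l then if p = j then h else 0 else 0))) \<and>
    (\<forall>p<n. \<forall>q<n. Q p q = (if p = q then h else 0)) \<and>
    (\<forall>p<n. \<forall>q<n. M p q = M q p) \<and>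
    (\<forall>p<n. \<forall>q<n. \<forall>a<n. \<forall>b<n. M p a * M q b = M q b * M p a)"

lemma symmetric_relationsD:
  assumes "symmetric_relations n h M Y Q"
  shows symmetric_relations_central: "h * x = x * h"
    and symmetric_relations_commutator: "l < n \<Longrightarrow> j < n \<Longrightarrow> r < n \<Longrightarrow> p < n \<Longrightarrow>
      Y l j * M r p = M r p * Y l j +
        ((if r = j then if l = p then h else 0 else 0) + (if r = l then if p = j then h else 0 else 0))"
    and symmetric_relations_Q: "p < n \<Longrightarrow> q < n \<Longrightarrow> Q p q = (if p = q then h else 0)"
    and symmetric_relations_sym: "p < n \<Longrightarrow> q < n \<Longrightarrow> M p q = M q p"
    and symmetric_relations_commute: "p < n \<Longrightarrow> q < n \<Longrightarrow> a < n \<Longrightarrow> b < n \<Longrightarrow>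
      M p a * M q b = M q b * M p a"
  using assms unfolding symmetric_relations_def by meson+

context grassmann
begin

abbreviation column :: "(nat \<Rightarrow> nat \<Rightarrow> 'b) \<Rightarrow> nat \<Rightarrow> 'r"
  where "column Z j \<equiv> vec (\<lambda>p. Z p j)"

context
  fixes M Y Q :: "nat \<Rightarrow> nat \<Rightarrow> 'b"
  assumes rel: "manin_relations n M Y Q"
begin

lemma manin_commutator:
  assumes "a < n" "j < n" "b < n"
  shows "L (Y a j) * column M b = column M b * L (Y a j) + (if a = b then column Q j else 0)"
proof -
  have "L (Y a j) * column M b = vec (\<lambda>p. M p b * Y a j + (if a = b then Q p j else 0))"
    unfolding L_mult_vec
  proof (rule vec_cong)
    fix r assume "r < n"
    thus "Y a j * M r b = M r b * Y a j + (if a = b then Q r j else 0)"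
      using assms by (intro manin_relations_commutator[OF rel])
  qed
  also have "\<dots> = column M b * L (Y a j) + (if a = b then column Q j else 0)"
    by (cases "a = b") (simp_all add: vec_add vec_mult_L)
  finally show ?thesis .
qed

lemma manin_columns: "anticommuting n (column M)"
  unfolding anticommuting_def
proof (intro conjI allI impI)
  fix a b assume ab: "a < n" "b < n"
  show "column M a * column M b = - (column M b * column M a)"
  proof (rule vec_anticomm_if_symmetric)
    fix p q assume pq: "p < n" "q < n"
    have "M p a * M q b - M q b * M p a = M q a * M p b - M p b * M q a"
      by (rule manin_relations_cross[OF rel pq ab])
    thus "M p a * M q b + M p b * M q a = M q a * M p b + M q b * M p a"
      by (simp add: algebra_simps)
  qed
next
  fix a assume a: "a < n"
  show "column M a * column M a = 0"
    by (rule vec_square) (rule manin_relations_column[OF rel _ _ a])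
qed

text \<open>Commute \<open>Y\<^sub>b\<^sub>j\<close> with the square of column \<open>b\<close> of \<open>M\<close>, which is zero.\<close>

lemma manin_Q_anticomm:
  assumes "j < n" "b < n"
  shows "column Q j * column M b = - (column M b * column Q j)"
proof -
  let ?y = "L (Y b j)" and ?m = "column M b" and ?q = "column Q j"
  have ym: "?y * ?m = ?m * ?y + ?q" using manin_commutator[OF assms(2,1,2)] by simp
  have mm: "?m * ?m = 0" by (rule anticommuting_square[OF manin_columns assms(2)])
  have "0 = ?y * ?m * ?m" by (simp add: mult.assoc mm)
  also have "\<dots> = (?m * ?y + ?q) * ?m" by (simp only: ym)
  also have "\<dots> = ?m * (?y * ?m) + ?q * ?m" by (simp only: distrib_right mult.assoc)
  also have "\<dots> = ?m * ?m * ?y + ?m * ?q + ?q * ?m"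
    unfolding ym by (simp add: distrib_left mult.assoc)
  finally show ?thesis by (simp add: mm eq_neg_iff_add_eq_0 add.commute)
qed

lemma manin_capelli_system: "capelli_system n (column M) (\<lambda>a j. L (Y a j)) (column Q)"
proof
  show "anticommuting n (column M)" by (rule manin_columns)
  fix j b assume jb: "j < n" "b < n"
  show "column Q j * column M b = - (column M b * column Q j)" by (rule manin_Q_anticomm[OF jb])
  have "(\<Sum>a<n. column M a * (L (Y a j) * column M b - column M b * L (Y a j)))
      = (\<Sum>a<n. if a = b then column M b * column Q j else 0)"
    using jb by (intro sum.cong) (auto simp: manin_commutator)
  thus "(\<Sum>a<n. column M a * (L (Y a j) * column M b - column M b * L (Y a j)))
      = - (column Q j * column M b)"
    using jb by (simp add: manin_Q_anticomm[OF jb])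
qed

context
  fixes j :: nat and h :: 'b
  assumes Y: "\<And>a b. a < n \<Longrightarrow> b < n \<Longrightarrow> Y a j * Y b j = Y b j * Y a j"
    and j: "j < n" and n: "1 < n" and half: "h + h = 1"
begin

lemma manin_Y_Q_commute:
  assumes a: "a < n"
  shows "L (Y a j) * column Q j = column Q j * L (Y a j)"
  unfolding L_mult_vec vec_mult_L
proof (rule vec_cong)
  fix r assume r: "r < n"
  \<comment> \<open>\<open>Q\<^sub>r\<^sub>j = [Y\<^sub>b\<^sub>j, M\<^sub>r\<^sub>b]\<close> for an index \<open>b\<close> different from \<open>a\<close>, and \<open>Y\<^sub>a\<^sub>j\<close> commutes with both factors.\<close>
  obtain b where b: "b < n" "b \<noteq> a"
    using n that[of "if a = 0 then 1 else 0"] by (simp split: if_splits)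
  have R: "Y l j * M r p = M r p * Y l j + (if l = p then Q r j else 0)" if "l < n" "p < n" for l p
    by (rule manin_relations_commutator[OF rel that(1) j r that(2)])
  have yq: "Q r j = Y b j * M r b - M r b * Y b j" using R[OF b(1) b(1)] by simp
  have ym: "Y a j * M r b = M r b * Y a j" using R[OF a b(1)] b(2) by simp
  have "Y a j * (Y b j * M r b) = Y b j * (Y a j * M r b)"
    by (simp only: mult.assoc[symmetric] Y[OF a b(1)])
  hence "Y a j * (Y b j * M r b) = Y b j * M r b * Y a j" by (simp only: ym mult.assoc)
  moreover have "Y a j * (M r b * Y b j) = M r b * (Y a j * Y b j)"
    by (simp only: mult.assoc[symmetric] ym)
  hence "Y a j * (M r b * Y b j) = M r b * Y b j * Y a j"
    by (simp only: Y[OF a b(1)] mult.assoc)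
  ultimately show "Y a j * Q r j = Q r j * Y a j"
    by (simp only: yq right_diff_distrib left_diff_distrib)
qed

text \<open>Commute \<open>Y\<^sub>0\<^sub>j\<close> with the relation of \<open>manin_Q_anticomm\<close>; this gives twice the square.\<close>

lemma manin_Q_square: "column Q j * column Q j = 0"
proof -
  have "0 < n" using n by simp
  let ?y = "L (Y 0 j)" and ?m = "column M 0" and ?q = "column Q j"
  have ym: "?y * ?m = ?m * ?y + ?q" using manin_commutator[OF \<open>0 < n\<close> j \<open>0 < n\<close>] by simp
  have yq: "?y * ?q = ?q * ?y" by (rule manin_Y_Q_commute[OF \<open>0 < n\<close>])
  have qm: "?q * ?m + ?m * ?q = 0" using manin_Q_anticomm[OF j \<open>0 < n\<close>] by simp
  have "0 = ?y * (?q * ?m + ?m * ?q)" by (simp only: qm mult_zero_right)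
  also have "\<dots> = ?q * (?y * ?m) + (?y * ?m) * ?q"
    by (simp only: distrib_left mult.assoc[symmetric] yq)
  also have "\<dots> = (?q * ?m + ?m * ?q) * ?y + (?q * ?q + ?q * ?q)"
  proof -
    have "?m * ?y * ?q = ?m * ?q * ?y" by (simp only: mult.assoc yq)
    thus ?thesis unfolding ym by (simp add: distrib_left distrib_right mult.assoc)
  qed
  finally have two: "?q * ?q + ?q * ?q = 0" by (simp add: qm)
  have "?q * ?q = L (h + h) * (?q * ?q)" by (simp add: half L_one)
  also have "\<dots> = L h * (?q * ?q + ?q * ?q)" by (simp only: L_add distrib_left distrib_right)
  finally show ?thesis by (simp add: two)
qed

end
end

context
  fixes M Y Q :: "nat \<Rightarrow> nat \<Rightarrow> 'b" and h :: 'b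
  assumes rel: "symmetric_relations n h M Y Q"
begin

lemma h_central: "h * x = x * h"
  by (rule symmetric_relations_central[OF rel])

lemma symmetric_Q:
  assumes "j < n"
  shows "column Q j = g j * L h"
proof -
  have "column Q j = vec (\<lambda>p. if p = j then h else 0)"
    by (intro vec_cong symmetric_relations_Q[OF rel _ assms])
  thus ?thesis using vec_unit[OF assms] by simp
qed

lemma L_h_central: "L h * L x = L x * L h"
  using h_central[of x] by (simp only: L_mult[symmetric])

lemma symmetric_commutator:
  assumes "a < n" "j < n" "b < n"
  shows "L (Y a j) * column M b - column M b * L (Y a j)
    = (if a = b then g j * L h else 0) + (if b = j then g a * L h else 0)"
proof -
  have "L (Y a j) * column M b = vec (\<lambda>p. M p b * Y a j +
      ((if p = j then if a = b then h else 0 else 0) + (if p = a then if b = j then h else 0 else 0)))"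
    unfolding L_mult_vec
  proof (rule vec_cong)
    fix p assume "p < n"
    thus "Y a j * M p b = M p b * Y a j +
      ((if p = j then if a = b then h else 0 else 0) + (if p = a then if b = j then h else 0 else 0))"
      by (rule symmetric_relations_commutator[OF rel assms(1,2) _ assms(3)])
  qed
  thus ?thesis
    using vec_unit[of j "if a = b then h else 0"] vec_unit[of a "if b = j then h else 0"] assms
    by (simp add: vec_add vec_mult_L L_zero)
qed

lemma symmetric_capelli_system: "capelli_system n (column M) (\<lambda>a j. L (Y a j)) (column Q)"
proof
  have comm: "M p a * M q b = M q b * M p a" if "p < n" "q < n" "a < n" "b < n" for p q a b
    by (rule symmetric_relations_commute[OF rel that])
  show "anticommuting n (column M)"
    unfolding anticommuting_def
  proof (intro conjI allI impI)
    show "column M a * column M b = - (column M b * column M a)" if "a < n" "b < n" for a b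
      by (rule vec_anticomm) (rule comm[OF _ _ that])
    show "column M a * column M a = 0" if "a < n" for a
      by (rule vec_square) (rule comm[OF _ _ that that])
  qed
  fix j b assume jb: "j < n" "b < n"
  have gm: "g j * column M b = - (column M b * g j)"
    using vec_anticomm[of "\<lambda>p. if p = j then 1 else 0" "\<lambda>p. M p b"] vec_unit[OF jb(1), of 1]
    by (simp add: L_one)
  have hm: "L h * column M b = column M b * L h"
    unfolding L_mult_vec vec_mult_L by (intro vec_cong) (rule h_central)
  have "column Q j * column M b = g j * column M b * L h"
    by (simp add: symmetric_Q[OF jb(1)] mult.assoc hm)
  thus qm: "column Q j * column M b = - (column M b * column Q j)"
    by (simp add: symmetric_Q[OF jb(1)] gm mult.assoc)
  have "(\<Sum>a<n. column M a * g a) = (\<Sum>a<n. \<Sum>p<n. g p * g a * L (M p a))"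
    unfolding vec_def sum_distrib_right
    by (intro sum.cong refl) (metis g_L lessThan_iff mult.assoc)
  also have "\<dots> = (\<Sum>p<n. \<Sum>a<n. g p * g a * L (M p a))" by (rule sum.swap)
  also have "\<dots> = 0"
  proof (rule anticommuting_sum_sym[OF g_anticomm])
    fix p q assume "p < n" "q < n"
    hence "M p q = M q p" by (rule symmetric_relations_sym[OF rel])
    thus "L (M p q) = L (M q p)" by simp
  qed
  finally have z: "(\<Sum>a<n. column M a * g a) = 0" .
  have "(\<Sum>a<n. column M a * (L (Y a j) * column M b - column M b * L (Y a j)))
      = (\<Sum>a<n. (if a = b then column M b * (g j * L h) else 0)
          + (if b = j then column M a * g a * L h else 0))"
    using jb by (intro sum.cong) (auto simp: symmetric_commutator distrib_left mult.assoc)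
  also have "\<dots> = column M b * (g j * L h) + (if b = j then (\<Sum>a<n. column M a * g a) * L h else 0)"
    using jb by (simp add: sum.distrib sum_distrib_right)
  also have "\<dots> = column M b * column Q j" by (simp add: z symmetric_Q[OF jb(1)])
  finally show "(\<Sum>a<n. column M a * (L (Y a j) * column M b - column M b * L (Y a j)))
      = - (column Q j * column M b)"
    by (simp add: qm)
qed

lemma symmetric_Y_Q_commute: "j < n \<Longrightarrow> L (Y a j) * column Q j = column Q j * L (Y a j)"
  by (simp only: symmetric_Q) (metis L_h_central g_L mult.assoc)

lemma symmetric_Q_square:
  assumes j: "j < n"
  shows "column Q j * column Q j = 0"
proof -
  have "column Q j * column Q j = g j * g j * (L h * L h)"
    unfolding symmetric_Q[OF j] by (metis g_L[OF j] mult.assoc)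
  thus ?thesis by (simp add: anticommuting_square[OF g_anticomm j])
qed

end

text \<open>
  What the decomplexification needs from either kind of system: the Capelli identity for
  \<open>C = M Y + Q diag(n - 1, \<dots>, 0)\<close>, and the vanishing of a product of two shifted columns of \<open>C\<close>. The
  latter is a statement of degree two in the variables, so it is vacuous when there is only one.
\<close>

lemma
  fixes M Y Q C :: "nat \<Rightarrow> nat \<Rightarrow> 'b" and h :: 'b
  assumes rel: "manin_relations n M Y Q \<or> (\<exists>c. symmetric_relations n c M Y Q)"
    and C: "\<And>p j. p < n \<Longrightarrow> j < n \<Longrightarrow> C p j = (\<Sum>a<n. M p a * Y a j) + of_nat (n - Suc j) * Q p j"
  shows capelli_column_det: "prod_list (map g [0..<n]) * L (column_det n C)
      = prod_list (map g [0..<n]) * L (column_det n M * column_det n Y)"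
    and capelli_shift_product: "j < n \<Longrightarrow> h + h = 1 \<Longrightarrow> (\<And>x. h * x = x * h) \<Longrightarrow>
      (\<And>a b. a < n \<Longrightarrow> b < n \<Longrightarrow> Y a j * Y b j = Y b j * Y a j) \<Longrightarrow>
      vec (\<lambda>p. C p j + h * Q p j) * vec (\<lambda>p. C p j - h * Q p j) = 0"
proof -
  interpret capelli_system n "column M" "\<lambda>a j. L (Y a j)" "column Q"
    using rel manin_capelli_system symmetric_capelli_system by blast
  have C_column: "column C j = \<eta> j + of_nat (n - Suc j) * column Q j" if "j < n" for j
  proof -
    have "column C j = vec (\<lambda>p. (\<Sum>a<n. M p a * Y a j) + of_nat (n - Suc j) * Q p j)"
      using that by (intro vec_cong) (simp add: C)
    thus ?thesis
      by (simp add: vec_add vec_sum L_mult_vec[symmetric] L_of_nat \<eta>_def vec_mult_L del: of_nat_diff)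
  qed
  have "prod_list (map g [0..<n]) * L (column_det n C) = prod_list (map (column C) [0..<n])"
    by (simp add: prod_vec)
  also have "map (column C) [0..<n] = map (\<lambda>j. \<eta> j + of_nat (n - Suc j) * column Q j) [0..<n]"
    by (intro map_cong refl) (simp add: C_column del: of_nat_diff)
  also have "prod_list \<dots> = prod_list (map (column M) [0..<n]) * column_det n (\<lambda>a j. L (Y a j))"
    by (rule capelli)
  also have "prod_list (map (column M) [0..<n]) = prod_list (map g [0..<n]) * L (column_det n M)"
    by (rule prod_vec)
  finally show "prod_list (map g [0..<n]) * L (column_det n C)
      = prod_list (map g [0..<n]) * L (column_det n M * column_det n Y)"
    by (simp add: L_column_det L_mult mult.assoc)
  assume j: "j < n" and half: "h + h = 1" and h: "\<And>x. h * x = x * h"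
    and Y: "\<And>a b. a < n \<Longrightarrow> b < n \<Longrightarrow> Y a j * Y b j = Y b j * Y a j"
  show "vec (\<lambda>p. C p j + h * Q p j) * vec (\<lambda>p. C p j - h * Q p j) = 0"
  proof (cases "1 < n")
    case False
    hence "n = 1" using j by simp
    hence "{..<n} = {0}" "g 0 * g 0 = 0" using anticommuting_square[OF g_anticomm, of 0] by auto
    thus ?thesis by (simp add: vec_mult_vec)
  next
    case True
    let ?k = "of_nat (n - Suc j)" and ?q = "column Q j"
    have yq: "L (Y a j) * ?q = ?q * L (Y a j)" if "a < n" for a
      using rel
    proof (elim disjE exE)
      assume "manin_relations n M Y Q"
      thus ?thesis
        by (rule manin_Y_Q_commute[where Y = Y and j = j and h = h]) (fact Y j True half that)+
    next
      fix c assume "symmetric_relations n c M Y Q"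
      thus ?thesis by (rule symmetric_Y_Q_commute[OF _ j])
    qed
    have qq: "?q * ?q = 0"
      using rel
    proof (elim disjE exE)
      assume "manin_relations n M Y Q"
      thus ?thesis
        by (rule manin_Q_square[where Y = Y and j = j and h = h]) (fact Y j True half)+
    next
      fix c assume "symmetric_relations n c M Y Q"
      thus ?thesis by (rule symmetric_Q_square[OF _ j])
    qed
    have LY: "L (Y a j) * L (Y b j) = L (Y b j) * L (Y a j)" if "a < n" "b < n" for a b
      using Y[OF that] by (simp add: L_mult[symmetric])
    have "vec (\<lambda>p. C p j + h * Q p j) = \<eta> j + (?k + L h) * ?q"
      "vec (\<lambda>p. C p j - h * Q p j) = \<eta> j + (?k - L h) * ?q"
      by (simp_all add: vec_add vec_diff L_mult_vec[symmetric] C_column[OF j]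
          distrib_right left_diff_distrib del: of_nat_diff)
    moreover have "(\<eta> j + (?k + L h) * ?q) * (\<eta> j + (?k - L h) * ?q) = 0"
    proof (rule column_shift_product[OF j LY yq qq])
      have hv: "L h * vec X = vec X * L h" for X
        by (simp add: L_mult_vec vec_mult_L h)
      have "L h * \<eta> j = \<eta> j * L h"
        unfolding \<eta>_def sum_distrib_left sum_distrib_right
        by (intro sum.cong refl)
          (simp only: mult.assoc[symmetric] hv, simp only: mult.assoc L_mult[symmetric] h)
      thus "(?k - L h) * \<eta> j = \<eta> j * (?k - L h)"
        by (simp add: left_diff_distrib right_diff_distrib mult_of_nat_commute[of _ "\<eta> j"] del: of_nat_diff)
      show "(?k - L h) * ?q = ?q * (?k - L h)"
        by (simp add: left_diff_distrib right_diff_distrib mult_of_nat_commute[of _ ?q] hv del: of_nat_diff)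
      have "L h + L h = 1" by (simp only: L_add[symmetric] half L_one)
      thus "?k + L h = ?k - L h + 1" by (simp add: algebra_simps del: of_nat_diff)
    qed
    ultimately show ?thesis by simp
  qed
qed

end

section \<open>Terms of excessive degree\<close>

context grassmann
begin

text \<open>
  \<open>degree_ge k x\<close> holds for every \<open>x\<close> that is of degree at least \<open>k\<close> in the variables \<open>g\<close>, and for
  \<open>k > n\<close> it forces \<open>x = 0\<close>. In contrast to a definition by expansion it makes sense for elements
  that contain other variables.
\<close>

definition degree_ge :: "nat \<Rightarrow> 'r \<Rightarrow> bool"
  where "degree_ge k x \<longleftrightarrow> (\<forall>ps. set ps \<subseteq> {..<n} \<and> n < length ps + k \<longrightarrow> x * prod_list (map g ps) = 0)"

lemma degree_ge_0: "degree_ge 0 x"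
  unfolding degree_ge_def using anticommuting_prod_list_long[OF g_anticomm] by simp

lemma degree_ge_zero: "degree_ge k 0"
  by (simp add: degree_ge_def)

lemma degree_ge_Suc_n: "degree_ge (Suc n) x \<Longrightarrow> x = 0"
  by (auto simp: degree_ge_def dest: spec[of _ "[]"])

lemma degree_ge_Suc: "degree_ge (Suc k) x \<Longrightarrow> degree_ge k x"
  by (simp add: degree_ge_def)

lemma degree_ge_add: "degree_ge k x \<Longrightarrow> degree_ge k z \<Longrightarrow> degree_ge k (x + z)"
  by (simp add: degree_ge_def distrib_right)

lemma degree_ge_mult_L: 
  assumes "degree_ge k x"
  shows "degree_ge k (x * L a)"
  unfolding degree_ge_def
proof (intro allI impI)
  fix ps assume ps: "set ps \<subseteq> {..<n} \<and> n < length ps + k"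
  have "L a * prod_list (map g ps) = prod_list (map g ps) * L a"
    by (rule commute_prod_list) (use ps g_L in auto)
  thus "x * L a * prod_list (map g ps) = 0"
    using assms ps by (simp add: degree_ge_def mult.assoc) (simp add: mult.assoc[symmetric])
qed

lemma degree_ge_mult_anticomm:
  assumes x: "degree_ge k x" and a: "\<And>p. p < n \<Longrightarrow> a * g p = - (g p * a)"
  shows "degree_ge k (x * a)"
  unfolding degree_ge_def
proof (intro allI impI)
  fix ps assume ps: "set ps \<subseteq> {..<n} \<and> n < length ps + k"
  let ?G = "prod_list (map g ps)"
  have "a * z = - (z * a)" if z: "z \<in> set (map g ps)" for z
  proof -
    from z ps obtain p where "p < n" "z = g p" by auto
    thus ?thesis using a by simp
  qed
  from anticomm_prod_list[of "map g ps", OF this]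
  have "a * ?G = (- 1) ^ length ps * (?G * a)" by simp
  hence "x * a * ?G = x * ((- 1) ^ length ps * (?G * a))" by (simp add: mult.assoc)
  also have "\<dots> = (- 1) ^ length ps * (x * ?G * a)"
    by (cases "even (length ps)") (simp_all add: mult.assoc)
  also have "x * ?G = 0" using x ps by (simp add: degree_ge_def)
  finally show "x * a * ?G = 0" by simp
qed

lemma degree_ge_mult_g:
  assumes "degree_ge k x" "p < n"
  shows "degree_ge (Suc k) (x * g p)"
  unfolding degree_ge_def
proof (intro allI impI)
  fix ps assume "set ps \<subseteq> {..<n} \<and> n < length ps + Suc k"
  hence "x * prod_list (map g (p # ps)) = 0"
    using assms unfolding degree_ge_def by (intro assms(1)[unfolded degree_ge_def, rule_format]) auto
  thus "x * g p * prod_list (map g ps) = 0" by (simp add: mult.assoc)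
qed

lemma degree_ge_sum:
  "(\<And>p. p < (k::nat) \<Longrightarrow> degree_ge d (f p)) \<Longrightarrow> degree_ge d (\<Sum>p<k. f p)"
  by (induction k) (simp_all add: degree_ge_zero degree_ge_add)

lemma degree_ge_mult_vec: "degree_ge k x \<Longrightarrow> degree_ge (Suc k) (x * vec X)"
  unfolding vec_def sum_distrib_left mult.assoc[symmetric]
  by (intro degree_ge_sum degree_ge_mult_L degree_ge_mult_g)

text \<open>
  The product has \<open>n\<close> factors of degree at least one, so a single factor of degree two already makes
  the degree exceed \<open>n\<close>.
\<close>

lemma prod_drop_excess:
  assumes a: "\<And>j p. j < n \<Longrightarrow> p < n \<Longrightarrow> a j * g p = - (g p * a j)"
  shows "prod_list (map (\<lambda>j. a j * vec (X j) + vec (X j) * vec (X j) * L c) [0..<n])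
    = prod_list (map (\<lambda>j. a j * vec (X j)) [0..<n])"
proof -
  let ?u = "\<lambda>j. a j * vec (X j)" and ?v = "\<lambda>j. vec (X j) * vec (X j) * L c"
  let ?U = "\<lambda>k. prod_list (map ?u [0..<k])"
  let ?E = "\<lambda>k. prod_list (map (\<lambda>j. ?u j + ?v j) [0..<k]) - ?U k"
  have "degree_ge k (?U k) \<and> degree_ge (Suc k) (?E k)" if "k \<le> n" for k
    using that
  proof (induction k)
    case 0
    thus ?case by (simp add: degree_ge_0 degree_ge_zero)
  next
    case (Suc k)
    hence U: "degree_ge k (?U k)" and E: "degree_ge (Suc k) (?E k)" and k: "k < n" by simp_all
    have u: "degree_ge (Suc d) (x * ?u k)" if "degree_ge d x" for d x
      unfolding mult.assoc[symmetric]
      by (intro degree_ge_mult_vec degree_ge_mult_anticomm that a k)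
    have v: "degree_ge (Suc (Suc d)) (x * ?v k)" if "degree_ge d x" for d x
      unfolding mult.assoc[symmetric]
      by (intro degree_ge_mult_vec degree_ge_mult_L that)
    have "?E (Suc k) = ?U k * ?v k + (?E k * ?u k + ?E k * ?v k)"
      by (simp add: algebra_simps)
    moreover have "degree_ge (Suc (Suc k)) \<dots>"
      by (intro degree_ge_add u v U E degree_ge_Suc[OF v[OF E]])
    moreover have "?U (Suc k) = ?U k * ?u k" by simp
    ultimately show ?case using u[OF U] by metis
  qed
  hence "?E n = 0" using degree_ge_Suc_n by blast
  thus ?thesis by simp
qed

text \<open>New variables obtained from the old ones by a linear substitution with central coefficients.\<close>

lemma grassmann_linear:
  assumes c: "\<And>p r x. c p r * x = x * c p r"
  shows "grassmann L k (\<lambda>p. vec (c p))"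
proof
  show "vec (c p) * L a = L a * vec (c p)" for p a
    by (simp add: vec_mult_L L_mult_vec c[of p _ a])
  show "anticommuting k (\<lambda>p. vec (c p))"
    unfolding anticommuting_def using vec_anticomm vec_square c by blast
qed (fact L_add L_mult L_one)+

lemma vec_linear:
  assumes c: "\<And>p r x. c p r * x = x * c p r"
  shows "grassmann.vec L k (\<lambda>p. vec (c p)) X = vec (\<lambda>r. \<Sum>p<k. c p r * X p)"
proof -
  interpret G: grassmann L k "\<lambda>p. vec (c p)" by (rule grassmann_linear[OF c])
  show ?thesis by (simp add: G.vec_def vec_sum vec_mult_L)
qed

end

section \<open>A concrete Grassmann algebra\<close>

text \<open>
  Additive operators on the functions from sets of naturals to the ring of coefficients. Composition
  is associative for free, so no associativity of an exterior product has to be checked. The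
  operator \<open>gen p\<close> is the exterior multiplication by the \<open>p\<close>-th variable.
\<close>

typedef (overloaded) ('a::ring_1) fock_op =
  "{F :: (nat set \<Rightarrow> 'a) \<Rightarrow> nat set \<Rightarrow> 'a. \<forall>f f'. F (\<lambda>S. f S + f' S) = (\<lambda>S. F f S + F f' S)}"
  by (rule exI[of _ "\<lambda>f. f"]) simp

setup_lifting type_definition_fock_op

instantiation fock_op :: (ring_1) ring_1
begin

lift_definition zero_fock_op :: "'a fock_op" is "\<lambda>f S. 0" by simp
lift_definition one_fock_op :: "'a fock_op" is "\<lambda>f. f" by simp
lift_definition plus_fock_op :: "'a fock_op \<Rightarrow> 'a fock_op \<Rightarrow> 'a fock_op" is "\<lambda>F G f S. F f S + G f S"
  by (simp add: fun_eq_iff algebra_simps)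
lift_definition uminus_fock_op :: "'a fock_op \<Rightarrow> 'a fock_op" is "\<lambda>F f S. - F f S"
  by (simp add: fun_eq_iff)
lift_definition minus_fock_op :: "'a fock_op \<Rightarrow> 'a fock_op \<Rightarrow> 'a fock_op" is "\<lambda>F G f S. F f S - G f S"
  by (simp add: fun_eq_iff algebra_simps)
lift_definition times_fock_op :: "'a fock_op \<Rightarrow> 'a fock_op \<Rightarrow> 'a fock_op" is "\<lambda>F G f. F (G f)"
  by simp

instance
proof
  show "(0 :: 'a fock_op) \<noteq> 1"
    by transfer (metis zero_neq_one)
qed (transfer; simp add: fun_eq_iff algebra_simps)+

end

lift_definition scal :: "'a::ring_1 \<Rightarrow> 'a fock_op" is "\<lambda>a f S. a * f S"
  by (simp add: distrib_left)

text \<open>The sign of moving the variable \<open>p\<close> past the smaller elements of \<open>S\<close>.\<close>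

definition below_sign :: "nat \<Rightarrow> nat set \<Rightarrow> 'a::ring_1"
  where "below_sign p S = (- 1) ^ card {s \<in> S. s < p}"

lemma below_sign_commute: "below_sign p S * x = x * below_sign p S"
  by (cases "even (card {s \<in> S. s < p})") (simp_all add: below_sign_def)

lemma below_sign_delete_less:
  assumes "p < q" "p \<in> S"
  shows "below_sign q (S - {p}) = - below_sign q S"
proof -
  have "{s \<in> S. s < q} = insert p {s \<in> S - {p}. s < q}" using assms by auto
  moreover have "finite {s \<in> S - {p}. s < q}" by (rule finite_subset[of _ "{..<q}"]) auto
  ultimately have "card {s \<in> S. s < q} = Suc (card {s \<in> S - {p}. s < q})" by simp
  thus ?thesis by (simp add: below_sign_def)
qed

lemma below_sign_delete_greater: "p < q \<Longrightarrow> below_sign p (S - {q}) = below_sign p S"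
  unfolding below_sign_def by (intro arg_cong[of _ _ "\<lambda>A. (- 1) ^ card A"]) auto

lift_definition gen :: "nat \<Rightarrow> 'a::ring_1 fock_op" is
  "\<lambda>p f S. if p \<in> S then below_sign p S * f (S - {p}) else 0"
  by (simp add: fun_eq_iff distrib_left)

lemma gen_swap_less:
  assumes "p < q"
  shows "gen p * gen q = - (gen q * gen p :: 'a::ring_1 fock_op)"
  using assms
proof (transfer, intro ext)
  fix p q and f :: "nat set \<Rightarrow> 'a" and S
  assume pq: "p < (q::nat)"
  have d: "S - {p} - {q} = S - {q} - {p}" by auto
  show "(if p \<in> S then below_sign p S *
           (if q \<in> S - {p} then below_sign q (S - {p}) * f (S - {p} - {q}) else 0) else 0)
      = - (if q \<in> S then below_sign q S *
           (if p \<in> S - {q} then below_sign p (S - {q}) * f (S - {q} - {p}) else 0) else 0)"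
  proof (cases "p \<in> S \<and> q \<in> S")
    case True
    have "below_sign p S * (below_sign q S * x) = below_sign q S * (below_sign p S * x)" for x :: 'a
      by (metis below_sign_commute mult.assoc)
    thus ?thesis
      using True pq by (simp add: below_sign_delete_less below_sign_delete_greater d)
  qed auto
qed

lemma grassmann_scal_gen: "grassmann scal n gen"
proof
  show "scal (a + b) = scal a + scal b" for a b :: 'a
    by transfer (simp add: fun_eq_iff distrib_right)
  show "scal (a * b) = scal a * scal b" for a b :: 'a
    by transfer (simp add: fun_eq_iff mult.assoc)
  show "scal (1 :: 'a) = 1"
    by transfer simp
  show "gen p * scal a = scal a * gen p" for p and a :: 'a
  proof (transfer, intro ext)
    fix p and a :: 'a and f :: "nat set \<Rightarrow> 'a" and S
    have "below_sign p S * (a * f (S - {p})) = a * (below_sign p S * f (S - {p}))"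
      by (metis below_sign_commute mult.assoc)
    thus "(if p \<in> S then below_sign p S * (a * f (S - {p})) else 0)
        = a * (if p \<in> S then below_sign p S * f (S - {p}) else 0)"
      by simp
  qed
  show "anticommuting n (gen :: nat \<Rightarrow> 'a fock_op)"
    unfolding anticommuting_def
  proof (intro conjI allI impI)
    have sq: "gen p * gen p = (0 :: 'a fock_op)" for p
      by transfer (auto simp: fun_eq_iff)
    thus "gen p * gen p = (0 :: 'a fock_op)" for p .
    show "gen p * gen q = - (gen q * gen p :: 'a fock_op)" for p q
    proof (cases p q rule: linorder_cases)
      case equal
      thus ?thesis using sq[of p] by simp
    next
      case greater
      thus ?thesis using gen_swap_less[of q p, where 'a = 'a] by simp
    qed (rule gen_swap_less)
  qed
qed

lemma Rep_fock_op_gen_top: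
  fixes f :: "nat set \<Rightarrow> 'a::ring_1"
  assumes "k \<le> N"
  shows "Rep_fock_op (prod_list (map gen [k..<N])) f {k..<N} = f {}"
  using assms
proof (induction k rule: inc_induct)
  case base
  thus ?case by (simp add: one_fock_op.rep_eq)
next
  case (step k)
  have "{s \<in> {k..<N}. s < k} = {}" by auto
  hence "below_sign k {k..<N} = (1 :: 'a)"
    by (simp only: below_sign_def card.empty power_0)
  moreover have "{k..<N} - {k} = {Suc k..<N}" by auto
  ultimately show ?case
    using step by (simp add: upt_conv_Cons times_fock_op.rep_eq gen.rep_eq)
qed

text \<open>Apply both operators to a function that does not vanish at the empty set, and evaluate at the top.\<close>

lemma top_coefficient_eq:
  fixes a b :: "'a::ring_1"
  assumes "prod_list (map gen [0..<N]) * scal a = prod_list (map gen [0..<N]) * scal b"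
  shows "a = b"
proof -
  have "a = Rep_fock_op (prod_list (map gen [0..<N]) * scal a) (\<lambda>S. 1) {0..<N}" for a :: 'a
    unfolding times_fock_op.rep_eq by (simp add: Rep_fock_op_gen_top scal.rep_eq)
  thus ?thesis using assms by metis
qed

section \<open>Column-determinants of decomplexified matrices\<close>

lemma prod_list_pairs:
  "prod_list (map f [0..<2 * n]) = (prod_list (map (\<lambda>j. f (2 * j) * f (Suc (2 * j))) [0..<n]) :: 'r::ring_1)"
  by (induction n) (simp_all add: mult.assoc)

lemma sum_pairs:
  "(\<Sum>r<2 * n. f r) = (\<Sum>p<n. f (2 * p) + f (Suc (2 * p)) :: 'r::ring_1)"
  by (induction n) (simp_all add: algebra_simps)

lemma mult_swap_middle:
  fixes a b c d :: "'r::ring_1"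
  assumes "b * c = c * b"
  shows "(a * b) * (c * d) = (a * c) * (b * d)"
proof -
  have "(a * b) * (c * d) = a * (b * c) * d" by (simp add: mult.assoc)
  thus ?thesis by (simp add: assms mult.assoc)
qed

text \<open>
  \<open>X\<close> is the decomplexification of \<open>C\<close>, with \<open>C'\<close> as its conjugate and \<open>h = 1/2\<close>, plus the contribution
  of \<open>Q\<close> times the blocks with entries \<open>1/4, i/4, i/4, -1/4\<close>. The relation \<open>shift\<close> is assumed for all
  Grassmann variables because the ones it is needed for are built in the proof.
\<close>

lemma column_det_doubled:
  fixes C C' Q :: "nat \<Rightarrow> nat \<Rightarrow> 'b::ring_1" and i h :: 'b
  assumes i: "i * i = - 1" "\<And>x. i * x = x * i" and h: "h + h = 1" "\<And>x. h * x = x * h"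
    and CC': "\<And>p q j l. p < n \<Longrightarrow> q < n \<Longrightarrow> j < n \<Longrightarrow> l < n \<Longrightarrow> C p j * C' q l = C' q l * C p j"
    and QC': "\<And>p q j l. p < n \<Longrightarrow> q < n \<Longrightarrow> j < n \<Longrightarrow> l < n \<Longrightarrow> Q p j * C' q l = C' q l * Q p j"
    and shift: "\<And>(g :: nat \<Rightarrow> 'b fock_op) j. grassmann scal n g \<Longrightarrow> j < n \<Longrightarrow>
      grassmann.vec scal n g (\<lambda>p. C p j + h * Q p j) * grassmann.vec scal n g (\<lambda>p. C p j - h * Q p j) = 0"
    and X_even: "\<And>r j. r < 2 * n \<Longrightarrow> j < n \<Longrightarrow> X r (2 * j) =
      (if even r then h * (C' (r div 2) j + (C (r div 2) j + h * Q (r div 2) j))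
       else i * (h * (C (r div 2) j + h * Q (r div 2) j - C' (r div 2) j)))"
    and X_odd: "\<And>r j. r < 2 * n \<Longrightarrow> j < n \<Longrightarrow> X r (Suc (2 * j)) =
      (if even r then i * (h * (C' (r div 2) j - (C (r div 2) j - h * Q (r div 2) j)))
       else h * (C' (r div 2) j + (C (r div 2) j - h * Q (r div 2) j)))"
  shows "column_det (2 * n) X = column_det n C * column_det n C'"
proof -
  interpret E: grassmann scal "2 * n" "gen :: nat \<Rightarrow> 'b fock_op" by (rule grassmann_scal_gen)
  define c where "c p r = (if r div 2 = p then if even r then i else - 1 else 0)" for p r :: nat
  define c' where "c' p r = (if r div 2 = p then if even r then h else - (i * h) else 0)" for p r :: nat
  have c: "c p r * x = x * c p r" for p r x by (simp add: c_def i(2))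
  have ih: "i * h * x = x * (i * h)" for x by (metis i(2) h(2) mult.assoc)
  have c': "c' p r * x = x * c' p r" for p r x by (simp add: c'_def h(2) ih)
  let ?\<psi> = "\<lambda>p. E.vec (c p)" and ?\<phi> = "\<lambda>p. E.vec (c' p)"
  interpret P: grassmann scal n ?\<psi> by (rule E.grassmann_linear[OF c])
  interpret F: grassmann scal n ?\<phi> by (rule E.grassmann_linear[OF c'])
  let ?I = "scal i" and ?H = "scal h"
  have II: "?I * ?I = - 1" by (simp add: E.L_mult[symmetric] i(1) E.L_minus E.L_one)
  have HH: "?H + ?H = 1" by (simp add: E.L_add[symmetric] h(1) E.L_one)
  have \<psi>\<phi>: "?\<psi> p * ?\<phi> q = - (?\<phi> q * ?\<psi> p)" for p q
    by (rule E.vec_anticomm) (rule c)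
  have anticomm: "P.vec Z * F.vec W = - (F.vec W * P.vec Z)"
    if "\<And>p q. p < n \<Longrightarrow> q < n \<Longrightarrow> Z p * W q = W q * Z p" for Z W
  proof -
    have "P.vec Z * F.vec W = (\<Sum>p<n. \<Sum>q<n. (?\<psi> p * scal (Z p)) * (?\<phi> q * scal (W q)))"
      by (simp add: P.vec_def F.vec_def sum_product)
    also have "\<dots> = (\<Sum>p<n. \<Sum>q<n. - ((?\<phi> q * scal (W q)) * (?\<psi> p * scal (Z p))))"
    proof (intro sum.cong refl)
      fix p q assume "p \<in> {..<n}" "q \<in> {..<n}"
      hence pq: "p < n" "q < n" by auto
      have "(?\<psi> p * scal (Z p)) * (?\<phi> q * scal (W q)) = (?\<psi> p * ?\<phi> q) * (scal (Z p) * scal (W q))"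
        by (rule mult_swap_middle) (rule F.g_L[OF pq(2), symmetric])
      also have "\<dots> = - (?\<phi> q * ?\<psi> p) * (scal (W q) * scal (Z p))"
        unfolding \<psi>\<phi> by (simp only: E.L_mult[symmetric] that[OF pq])
      also have "\<dots> = - ((?\<phi> q * ?\<psi> p) * (scal (W q) * scal (Z p)))" by simp
      also have "(?\<phi> q * ?\<psi> p) * (scal (W q) * scal (Z p))
          = (?\<phi> q * scal (W q)) * (?\<psi> p * scal (Z p))"
        by (rule mult_swap_middle) (rule P.g_L[OF pq(1)])
      finally show "(?\<psi> p * scal (Z p)) * (?\<phi> q * scal (W q))
        = - ((?\<phi> q * scal (W q)) * (?\<psi> p * scal (Z p)))" .
    qed
    also have "\<dots> = - (F.vec W * P.vec Z)"
      unfolding P.vec_def F.vec_def sum_product by (subst sum.swap) (simp add: sum_negf)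
    finally show ?thesis .
  qed
  have pick: "(\<Sum>p<n. c p r * Z p) = (if even r then i else - 1) * Z (r div 2)"
    "(\<Sum>p<n. c' p r * Z p) = (if even r then h else - (i * h)) * Z (r div 2)" if "r < 2 * n" for r Z
  proof -
    have "r div 2 < n" using that by simp
    thus "(\<Sum>p<n. c p r * Z p) = (if even r then i else - 1) * Z (r div 2)"
      "(\<Sum>p<n. c' p r * Z p) = (if even r then h else - (i * h)) * Z (r div 2)"
      unfolding c_def c'_def by (simp_all add: if_distrib[of "\<lambda>x. x * _"] cong: if_cong)
  qed
  have iix: "i * (i * x) = - x" for x by (simp add: mult.assoc[symmetric] i(1))
  have pair: "E.column X (2 * j) * E.column X (Suc (2 * j))
      = P.column C j * F.column C' j + F.column C' j * F.column C' j * ?I" if j: "j < n" for j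
  proof -
    define Pl where "Pl = P.vec (\<lambda>p. C p j + h * Q p j)"
    define Mi where "Mi = P.vec (\<lambda>p. C p j - h * Q p j)"
    define B where "B = F.column C' j"
    have zero: "Pl * Mi = 0" unfolding Pl_def Mi_def by (rule shift[OF P.grassmann_axioms j])
    have hQC': "h * Q p j * C' r j = C' r j * (h * Q p j)" if "p < n" "r < n" for p r
      by (metis QC'[OF that j j] h(2) mult.assoc)
    have PlB: "Pl * B = - (B * Pl)"
      unfolding Pl_def B_def
      by (rule anticomm) (simp only: distrib_left distrib_right CC' hQC' j)
    have MiB: "Mi * B = - (B * Mi)"
      unfolding Mi_def B_def
      by (rule anticomm) (simp only: left_diff_distrib right_diff_distrib CC' hQC' j)
    have sumPM: "?H * (Pl + Mi) = P.column C j"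
    proof -
      have "Pl + Mi = P.column C j + P.column C j"
        by (simp add: Pl_def Mi_def P.vec_add P.vec_diff)
      hence "?H * (Pl + Mi) = (?H + ?H) * P.column C j" by (simp add: distrib_left distrib_right)
      thus ?thesis by (simp add: HH)
    qed
    have col0: "E.column X (2 * j) = B - ?I * (?H * Pl)"
    proof -
      have "B - ?I * (?H * Pl) = E.vec (\<lambda>r. (\<Sum>p<n. c' p r * C' p j)
          - i * (h * (\<Sum>p<n. c p r * (C p j + h * Q p j))))"
        unfolding B_def Pl_def E.vec_linear[OF c] E.vec_linear[OF c'] E.L_mult_vec E.vec_diff ..
      also have "\<dots> = E.column X (2 * j)"
      proof (rule E.vec_cong)
        fix r assume r: "r < 2 * n"
        have "i * (h * (i * x)) = - (h * x)" for x by (metis iix h(2) mult.assoc mult_minus_right)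
        thus "(\<Sum>p<n. c' p r * C' p j) - i * (h * (\<Sum>p<n. c p r * (C p j + h * Q p j))) = X r (2 * j)"
          unfolding pick[OF r] X_even[OF r j] by (simp add: distrib_left right_diff_distrib mult.assoc)
      qed
      finally show ?thesis ..
    qed
    have col1: "E.column X (Suc (2 * j)) = ?I * B - ?H * Mi"
    proof -
      have "?I * B - ?H * Mi = E.vec (\<lambda>r. i * (\<Sum>p<n. c' p r * C' p j)
          - h * (\<Sum>p<n. c p r * (C p j - h * Q p j)))"
        unfolding B_def Mi_def E.vec_linear[OF c] E.vec_linear[OF c'] E.L_mult_vec E.vec_diff ..
      also have "\<dots> = E.column X (Suc (2 * j))"
      proof (rule E.vec_cong)
        fix r assume r: "r < 2 * n"
        have "h * (i * x) = i * (h * x)" for x by (metis h(2) mult.assoc)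
        thus "i * (\<Sum>p<n. c' p r * C' p j) - h * (\<Sum>p<n. c p r * (C p j - h * Q p j)) = X r (Suc (2 * j))"
          unfolding pick[OF r] X_odd[OF r j]
          by (simp add: distrib_left right_diff_distrib mult.assoc iix)
      qed
      finally show ?thesis ..
    qed
    have IB: "?I * B = B * ?I" "?H * B = B * ?H"
      unfolding B_def F.L_mult_vec F.vec_mult_L by (simp_all add: i(2) h(2))
    have HPl: "?I * Pl = Pl * ?I" "?H * Pl = Pl * ?H"
      unfolding Pl_def P.L_mult_vec P.vec_mult_L by (simp_all add: i(2)[of "_ + _"] h(2)[of "_ + _"])
    have IH: "?I * ?H = ?H * ?I" by (simp add: E.L_mult[symmetric] h(2))
    have "E.column X (2 * j) * E.column X (Suc (2 * j))
        = B * (?I * B) - B * (?H * Mi) - ?I * (?H * Pl) * (?I * B) + ?I * (?H * Pl) * (?H * Mi)"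
      unfolding col0 col1 by (simp add: algebra_simps)
    also have "B * (?I * B) = B * B * ?I" by (simp only: IB mult.assoc)
    also have "B * (?H * Mi) = - (?H * (Mi * B))"
    proof -
      have "B * (?H * Mi) = ?H * (B * Mi)" by (metis IB(2) mult.assoc)
      thus ?thesis by (simp add: MiB)
    qed
    also have "?I * (?H * Pl) * (?I * B) = - (?H * (Pl * B))"
    proof -
      have "?I * (?H * Pl) * (?I * B) = (?I * ?I) * (?H * (Pl * B))"
        by (metis HPl(1) IH mult.assoc)
      thus ?thesis by (simp add: II)
    qed
    also have "?I * (?H * Pl) * (?H * Mi) = 0"
    proof -
      have "?I * (?H * Pl) * (?H * Mi) = ?I * (?H * (?H * (Pl * Mi)))"
        by (metis HPl(2) mult.assoc)
      thus ?thesis by (simp add: zero)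
    qed
    finally have "E.column X (2 * j) * E.column X (Suc (2 * j))
        = B * B * ?I + ?H * (Pl + Mi) * B"
      by (simp add: algebra_simps)
    thus ?thesis unfolding sumPM B_def by (simp add: add.commute)
  qed
  have gen_pair: "gen (2 * p) * gen (Suc (2 * p)) = ?\<psi> p * ?\<phi> p" if p: "p < n" for p
  proof -
    let ?e = "gen (2 * p) :: 'b fock_op" and ?e' = "gen (Suc (2 * p)) :: 'b fock_op"
    have one: "scal (- 1) = (- 1 :: 'b fock_op)" by (simp add: E.L_minus E.L_one)
    have \<psi>: "?\<psi> p = ?e * ?I - ?e'"
    proof -
      have "?\<psi> p = (\<Sum>q<n. if q = p then ?e * ?I - ?e' else 0)"
        unfolding E.vec_def sum_pairs by (intro sum.cong) (auto simp: c_def E.L_zero one)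
      thus ?thesis using p by simp
    qed
    have \<phi>: "?\<phi> p = ?e * ?H - ?e' * (?I * ?H)"
    proof -
      have "?\<phi> p = (\<Sum>q<n. if q = p then ?e * ?H - ?e' * (?I * ?H) else 0)"
        unfolding E.vec_def sum_pairs
        by (intro sum.cong) (auto simp: c'_def E.L_zero E.L_minus E.L_mult)
      thus ?thesis using p by simp
    qed
    have b: "2 * p < 2 * n" "Suc (2 * p) < 2 * n" using p by auto
    have ee: "?e * ?e = 0" "?e' * ?e' = 0" "?e' * ?e = - (?e * ?e')"
      using anticommuting_square[OF E.g_anticomm] anticommuting_swap[OF E.g_anticomm] b by metis+
    have "?\<psi> p * ?\<phi> p = ?e * ?I * (?e * ?H) - ?e * ?I * (?e' * (?I * ?H)) - ?e' * (?e * ?H)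
        + ?e' * (?e' * (?I * ?H))"
      unfolding \<psi> \<phi> by (simp add: algebra_simps)
    also have "?e * ?I * (?e * ?H) = ?e * ?e * (?I * ?H)"
      by (rule mult_swap_middle) (rule E.g_L[OF b(1), symmetric])
    also have "?e * ?I * (?e' * (?I * ?H)) = ?e * ?e' * ((?I * ?I) * ?H)"
      unfolding mult.assoc[of ?I ?I] by (rule mult_swap_middle) (rule E.g_L[OF b(2), symmetric])
    also have "?e' * (?e * ?H) = - (?e * ?e') * ?H" by (metis ee(3) mult.assoc)
    also have "?e' * (?e' * (?I * ?H)) = 0" by (simp add: mult.assoc[symmetric] ee(2))
    also have "?e * ?e * (?I * ?H) - ?e * ?e' * ((?I * ?I) * ?H) - - (?e * ?e') * ?H + 0
        = ?e * ?e' * (?H + ?H)"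
      by (simp add: ee(1) II distrib_left)
    finally show ?thesis by (simp add: HH)
  qed
  let ?s = "(- 1 :: 'b fock_op) ^ (n * (n - 1) div 2)"
  let ?P = "prod_list (map ?\<psi> [0..<n])" and ?F = "prod_list (map ?\<phi> [0..<n])"
  have "prod_list (map gen [0..<2 * n]) * scal (column_det (2 * n) X)
      = prod_list (map (E.column X) [0..<2 * n])"
    by (rule E.prod_vec[symmetric])
  also have "\<dots> = prod_list (map (\<lambda>j. E.column X (2 * j) * E.column X (Suc (2 * j))) [0..<n])"
    by (rule prod_list_pairs)
  also have "\<dots> = prod_list (map (\<lambda>j. P.column C j * F.column C' j
      + F.column C' j * F.column C' j * ?I) [0..<n])"
    by (intro arg_cong[of _ _ prod_list] map_cong refl pair) simp
  also have "\<dots> = prod_list (map (\<lambda>j. P.column C j * F.column C' j) [0..<n])"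
  proof (rule F.prod_drop_excess)
    fix j p assume "j < n" "p < n"
    have "P.column C j * F.vec (\<lambda>q. if q = p then 1 else 0)
        = - (F.vec (\<lambda>q. if q = p then 1 else 0) * P.column C j)"
      by (rule anticomm) simp
    thus "P.column C j * ?\<phi> p = - (?\<phi> p * P.column C j)"
      using F.vec_unit[OF \<open>p < n\<close>, of 1] by (simp add: E.L_one)
  qed
  also have "\<dots> = ?s * (prod_list (map (P.column C) [0..<n]) * prod_list (map (F.column C') [0..<n]))"
    by (rule prod_list_interleave) (rule anticomm, rule CC')
  also have "\<dots> = ?s * (?P * scal (column_det n C) * (?F * scal (column_det n C')))"
    by (simp only: P.prod_vec F.prod_vec)
  also have "\<dots> = ?s * (?P * ?F) * scal (column_det n C * column_det n C')"
  proof -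
    have "scal (column_det n C) * ?F = ?F * scal (column_det n C)"
      by (rule commute_prod_list) (auto simp: F.g_L)
    thus ?thesis
      unfolding E.L_mult mult.assoc[of ?s] by (simp only: mult_swap_middle)
  qed
  also have "?s * (?P * ?F) = prod_list (map (\<lambda>p. ?\<psi> p * ?\<phi> p) [0..<n])"
    by (rule prod_list_interleave[symmetric]) (rule \<psi>\<phi>)
  also have "\<dots> = prod_list (map (\<lambda>p. gen (2 * p) * gen (Suc (2 * p))) [0..<n])"
    by (intro arg_cong[of _ _ prod_list] map_cong refl gen_pair[symmetric]) simp
  also have "\<dots> = prod_list (map gen [0..<2 * n])"
    by (rule prod_list_pairs[symmetric])
  finally show ?thesis by (rule top_coefficient_eq)
qed

section \<open>Entries of the block matrices\<close>

lemma re_im_simps [simp]: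
  "re 0 = 0" "im 0 = 0" "re 1 = 1" "im 1 = 0"
  "re (x + y) = re x + re y" "im (x + y) = im x + im y"
  "re (x - y) = re x - re y" "im (x - y) = im x - im y"
  "re (- x) = - re x" "im (- x) = - im x"
  "re (x * y) = re x * re y - im x * im y" "im (x * y) = re x * im y + im x * re y"
  for x y :: "'a::ring_1 cx"
  by (simp_all add: zero_cx_def one_cx_def plus_cx_def minus_cx_def uminus_cx_def times_cx_def)

lemma re_im_sum [simp]:
  "re (\<Sum>a\<in>A. f a) = (\<Sum>a\<in>A. re (f a))" "im (\<Sum>a\<in>A. f a) = (\<Sum>a\<in>A. im (f a))"
  for f :: "'i \<Rightarrow> 'a::ring_1 cx"
  by (induction A rule: infinite_finite_induct) simp_all

lemma re_im_of_nat [simp]: "re (of_nat k :: 'a::ring_1 cx) = of_nat k" "im (of_nat k :: 'a::ring_1 cx) = 0"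
  by (induction k) simp_all

lemma re_im_cx_of [simp]: "re (cx_of a) = a" "im (cx_of a) = 0"
  by (simp_all add: cx_of_def)

lemma re_im_cx_conj [simp]: "re (cx_conj x) = re x" "im (cx_conj x) = - im x"
  by (simp_all add: cx_conj_def)

lemma cx_conj_add: "cx_conj (x + y) = cx_conj x + cx_conj y"
  by (simp add: cx.expand)

lemma cx_conj_mult: "cx_conj (x * y) = cx_conj x * cx_conj y"
  by (simp add: cx.expand)

lemma cx_conj_one: "cx_conj 1 = 1"
  by (simp add: cx.expand)

lemma column_det_cx_conj: "cx_conj (column_det n Z) = column_det n (\<lambda>p j. cx_conj (Z p j))"
  by (rule ring_hom_column_det) (fact cx_conj_add cx_conj_mult cx_conj_one)+

lemma column_det_cx_of: "cx_of (column_det n Z) = column_det n (\<lambda>p j. cx_of (Z p j))"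
  by (rule ring_hom_column_det) (simp_all add: cx.expand)

lemma det_col_eq_column_det: "dim_col A = n \<Longrightarrow> det_col A = column_det n (\<lambda>p j. A $$ (p, j))"
  by (simp add: det_col_def column_det_def)

lemma decomplexify_index:
  assumes "N \<in> carrier_mat n m" "p < 2 * n" "q < 2 * m"
  shows "decomplexify N $$ (p, q) = (let z = N $$ (p div 2, q div 2) in
      if even p then (if even q then re z else im z) else (if even q then - im z else re z))"
  using assms by (simp add: decomplexify_def)

lemma sum_block_diagonal:
  fixes f :: "nat \<Rightarrow> 'r::ring_1"
  assumes "j < n" "\<And>r. r < 2 * n \<Longrightarrow> r div 2 \<noteq> j \<Longrightarrow> f r = 0"
  shows "(\<Sum>r<2 * n. f r) = f (2 * j) + f (Suc (2 * j))"
proof -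
  have "f (2 * p) + f (Suc (2 * p)) = (if p = j then f (2 * j) + f (Suc (2 * j)) else 0)"
    if "p < n" for p
    using that assms(2)[of "2 * p"] assms(2)[of "Suc (2 * p)"] by simp
  hence "(\<Sum>r<2 * n. f r) = (\<Sum>p<n. if p = j then f (2 * j) + f (Suc (2 * j)) else 0)"
    unfolding sum_pairs by (intro sum.cong) simp_all
  thus ?thesis using assms(1) by simp
qed

text \<open>The map \<open>k \<rightarrow> A\<close>, \<open>c \<mapsto> c 1\<close>.\<close>

context unital_algebra
begin

lemma scalar_central: "scale c 1 * x = x * scale c 1"
  using scale_mult_left[of c 1 x] scale_mult_right[of x c 1] by simp

lemma scalar_mult: "scale (a * b) 1 = scale a 1 * scale b 1"
  using scale_mult_left[of a 1 "scale b 1"] by simp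

lemma scalar_of_nat: "scale (of_nat k) 1 = of_nat k"
  by (induction k) (simp_all add: scale_left_distrib)

end

section \<open>The decomplexified Capelli identity\<close>

text \<open>
  The correction matrix vanishes here: the columns of \<open>N\<close> have commuting entries, so their associated
  Grassmann elements square to zero.
\<close>

lemma column_det_decomplexify:
  fixes hf :: "'a::ring_1" and N :: "'a cx mat"
  defines "z \<equiv> \<lambda>p j. N $$ (p, j)"
  assumes N: "N \<in> carrier_mat n n"
    and hf: "hf + hf = 1" "\<And>x. hf * x = x * hf"
    and column: "\<And>p q j. p < n \<Longrightarrow> q < n \<Longrightarrow> j < n \<Longrightarrow> z p j * z q j = z q j * z p j"
    and conj: "\<And>p q j l. p < n \<Longrightarrow> q < n \<Longrightarrow> j < n \<Longrightarrow> l < n \<Longrightarrow>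
      z p j * cx_conj (z q l) = cx_conj (z q l) * z p j"
  shows "cx_of (det_col (decomplexify N)) = column_det n z * cx_conj (column_det n z)"
proof -
  have hf_double: "hf * x + hf * x = x" for x
    using hf(1) by (metis distrib_right mult_1)
  have dim: "dim_col (decomplexify N) = 2 * n" using N by (simp add: decomplexify_def)
  have "cx_of (det_col (decomplexify N)) = column_det (2 * n) (\<lambda>r s. cx_of (decomplexify N $$ (r, s)))"
    by (simp only: det_col_eq_column_det[OF dim] column_det_cx_of)
  also have "\<dots> = column_det n z * column_det n (\<lambda>p j. cx_conj (z p j))"
  proof (rule column_det_doubled[where Q = "\<lambda>_ _. 0" and i = "Cx 0 1" and h = "cx_of hf"])
    show "Cx 0 1 * Cx 0 1 = (- 1 :: 'a cx)" "Cx 0 1 * x = x * Cx 0 1" for x :: "'a cx"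
      by (simp_all add: cx.expand)
    show "cx_of hf + cx_of hf = 1" "cx_of hf * x = x * cx_of hf" for x
      using hf by (simp_all add: cx.expand)
    show "z p j * cx_conj (z q l) = cx_conj (z q l) * z p j" if "p < n" "q < n" "j < n" "l < n" for p q j l
      by (rule conj[OF that])
    show "grassmann.vec scal n g (\<lambda>p. z p j + cx_of hf * 0) * grassmann.vec scal n g (\<lambda>p. z p j - cx_of hf * 0) = 0"
      if "grassmann scal n g" and j: "j < n" for g :: "nat \<Rightarrow> 'a cx fock_op" and j
    proof -
      interpret grassmann scal n g by fact
      show ?thesis by (simp, rule vec_square, rule column[OF _ _ j])
    qed
  next
    fix r j assume r: "r < 2 * n" and j: "j < n"
    have ent: "decomplexify N $$ (r, 2 * j) = (if even r then re (z (r div 2) j) else - im (z (r div 2) j))"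
      "decomplexify N $$ (r, Suc (2 * j)) = (if even r then im (z (r div 2) j) else re (z (r div 2) j))"
      using r j by (simp_all add: decomplexify_index[OF N] z_def Let_def)
    show "cx_of (decomplexify N $$ (r, 2 * j)) = (if even r
        then cx_of hf * (cx_conj (z (r div 2) j) + (z (r div 2) j + cx_of hf * 0))
        else Cx 0 1 * (cx_of hf * (z (r div 2) j + cx_of hf * 0 - cx_conj (z (r div 2) j))))"
      by (simp add: ent cx.expand distrib_left hf_double)
    show "cx_of (decomplexify N $$ (r, Suc (2 * j))) = (if even r
        then Cx 0 1 * (cx_of hf * (cx_conj (z (r div 2) j) - (z (r div 2) j - cx_of hf * 0)))
        else cx_of hf * (cx_conj (z (r div 2) j) + (z (r div 2) j - cx_of hf * 0)))"
      by (simp add: ent cx.expand distrib_left right_diff_distrib hf_double)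
  qed simp
  finally show ?thesis by (simp only: column_det_cx_conj)
qed

lemma commute_sum:
  fixes x :: "'r::ring_1"
  shows "(\<And>a. a \<in> A \<Longrightarrow> x * f a = f a * x) \<Longrightarrow> x * sum f A = sum f A * x"
  unfolding sum_distrib_left sum_distrib_right by (rule sum.cong) simp_all

lemma commute_capelli_entry:
  fixes x :: "'r::ring_1"
  assumes "\<And>a. a < n \<Longrightarrow> x * m a = m a * x" "\<And>a. a < n \<Longrightarrow> x * y a = y a * x" "x * q = q * x"
  shows "x * ((\<Sum>a<n. m a * y a) + of_nat k * q) = ((\<Sum>a<n. m a * y a) + of_nat k * q) * x"
proof -
  have "x * (\<Sum>a<n. m a * y a) = (\<Sum>a<n. m a * y a) * x"
  proof (rule commute_sum)
    fix a assume "a \<in> {..<n}"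
    hence "a < n" by simp
    thus "x * (m a * y a) = m a * y a * x" by (metis assms(1,2) mult.assoc)
  qed
  moreover have "x * (of_nat k * q) = of_nat k * q * x"
    by (metis assms(3) mult.assoc mult_of_nat_commute)
  ultimately show ?thesis by (simp add: distrib_left distrib_right)
qed

theorem theorem6:
  fixes scale :: "'k::field \<Rightarrow> 'a::ring_1 \<Rightarrow> 'a"
    and n :: nat
    and M Y Q :: "'a cx mat"
  assumes char: "CHAR('k) \<noteq> 2"
    and alg: "unital_algebra scale"
    and dims: "M \<in> carrier_mat n n" "Y \<in> carrier_mat n n" "Q \<in> carrier_mat n n"
    and cases:
      "((\<forall>l<n. \<forall>j<n. \<forall>r<n. \<forall>p<n.
           commutator (Y $$ (l,j)) (M $$ (r,p)) = (if l = p then Q $$ (r,j) else 0))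
        \<and> manin_mat M)
       \<or>
       ((\<exists>h. (\<forall>x. h * x = x * h)
           \<and> (\<forall>i<n. \<forall>j<n. \<forall>k<n. \<forall>l<n.
                commutator (M $$ (i,j)) (Y $$ (k,l))
                  = - h * (of_bool (j = k) * of_bool (i = l) + of_bool (i = k) * of_bool (j = l)))
           \<and> Q = h \<cdot>\<^sub>m 1\<^sub>m n)
        \<and> transpose_mat M = M
        \<and> (\<forall>a\<in>elements_mat M. \<forall>b\<in>elements_mat M. commutator a b = 0))"
    and Y_col: "\<forall>a<n. \<forall>b<n. \<forall>k<n. commutator (Y $$ (a,k)) (Y $$ (b,k)) = 0"
    and conj_comm: "\<forall>\<alpha>\<in>elements_mat M \<union> elements_mat Y \<union> elements_mat Q.
      \<forall>\<beta>\<in>elements_mat M \<union> elements_mat Y \<union> elements_mat Q. commutator \<alpha> (cx_conj \<beta>) = 0"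
  shows "det_col (map_mat cx_of (decomplexify M) * map_mat cx_of (decomplexify Y)
            + map_mat cx_of (decomplexify Q) * map_mat (cx_scalar scale) (correction_mat n))
         = cx_of (det_col (decomplexify M)) * cx_of (det_col (decomplexify Y))"
proof -
  interpret unital_algebra scale by (rule alg)
  define m where "m p j = M $$ (p, j)" for p j
  define y where "y p j = Y $$ (p, j)" for p j
  define q where "q p j = Q $$ (p, j)" for p j
  define hf where "hf = scale (1 / 2) 1"
  define h where "h = cx_of hf"
  define i where "i = Cx (0 :: 'a) 1"
  define C where "C p j = (\<Sum>a<n. m p a * y a j) + of_nat (n - Suc j) * q p j" for p j
  let ?cc = "\<lambda>Z p j. cx_conj (Z p j)"
  have two: "(2 :: 'k) \<noteq> 0"
  proof
    assume "(2 :: 'k) = 0"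
    hence "of_nat 2 = (0 :: 'k)" by simp
    hence d: "CHAR('k) dvd 2" by (simp only: of_nat_eq_0_iff_char_dvd)
    have "CHAR('k) \<le> 2" using d by (rule dvd_imp_le) simp
    moreover have "CHAR('k) \<noteq> 0" using d by (intro notI) simp
    moreover have "CHAR('k) \<noteq> 1" using CHAR_not_1[where ?'a = 'k] by simp
    ultimately show False using char by linarith
  qed
  have hf_central: "hf * x = x * hf" for x unfolding hf_def by (rule scalar_central)
  have "hf + hf = scale (1 / 2 + 1 / 2) 1" unfolding hf_def by (rule scale_left_distrib[symmetric])
  also have "\<dots> = 1" using two by simp
  finally have hf2: "hf + hf = 1" .
  have hf_double: "hf * x + hf * x = x" for x
    using hf2 by (metis distrib_right mult_1)
  have h: "h + h = 1" "h * x = x * h" for x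
    by (simp_all add: h_def cx.expand hf2 hf_central)
  have i: "i * i = - 1" "i * x = x * i" for x
    by (simp_all add: i_def cx.expand)
  have entry: "m p j \<in> elements_mat M" "y p j \<in> elements_mat Y" "q p j \<in> elements_mat Q"
    if "p < n" "j < n" for p j
    using that dims by (auto simp: m_def y_def q_def)
  have conj: "\<alpha> * cx_conj \<beta> = cx_conj \<beta> * \<alpha>"
    if "\<alpha> \<in> elements_mat M \<union> elements_mat Y \<union> elements_mat Q"
      "\<beta> \<in> elements_mat M \<union> elements_mat Y \<union> elements_mat Q" for \<alpha> \<beta>
    using conj_comm that by (auto simp: commutator_def)
  have yy: "y a j * y b j = y b j * y a j" if "a < n" "b < n" "j < n" for a b j
    using Y_col that by (simp add: commutator_def y_def)
  \<comment> \<open>Both hypotheses, with the commutators of \<open>Y\<close> and \<open>M\<close> solved for \<open>Y\<^sub>l\<^sub>j M\<^sub>r\<^sub>p\<close>.\<close>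
  have rel: "manin_relations n m y q \<or> (\<exists>c. symmetric_relations n c m y q)"
    using cases
  proof (elim disjE conjE exE)
    assume c: "\<forall>l<n. \<forall>j<n. \<forall>r<n. \<forall>p<n.
           commutator (Y $$ (l,j)) (M $$ (r,p)) = (if l = p then Q $$ (r,j) else 0)"
      and manin: "manin_mat M"
    have dim: "dim_row M = n" "dim_col M = n" using dims(1) by auto
    have "manin_relations n m y q"
      unfolding manin_relations_def
    proof (intro conjI allI impI)
      show "y l j * m r p = m r p * y l j + (if l = p then q r j else 0)"
        if "l < n" "j < n" "r < n" "p < n" for l j r p
      proof -
        have "y l j * m r p - m r p * y l j = (if l = p then q r j else 0)"
          using c that unfolding m_def y_def q_def commutator_def by presburger
        thus ?thesis by (simp only: diff_eq_eq add.commute)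
      qed
      show "m p a * m r a = m r a * m p a" if "p < n" "r < n" "a < n" for p r a
      proof -
        have "m p a * m r a - m r a * m p a = 0"
          using manin that unfolding manin_mat_def dim m_def commutator_def by meson
        thus ?thesis by simp
      qed
      show "m p a * m r b - m r b * m p a = m r a * m p b - m p b * m r a"
        if "p < n" "r < n" "a < n" "b < n" for p r a b
        using manin that unfolding manin_mat_def dim m_def commutator_def by meson
    qed
    thus ?thesis ..
  next
    fix c assume c: "\<forall>x. c * x = x * c"
      and rel: "\<forall>i<n. \<forall>j<n. \<forall>k<n. \<forall>l<n. commutator (M $$ (i,j)) (Y $$ (k,l))
          = - c * (of_bool (j = k) * of_bool (i = l) + of_bool (i = k) * of_bool (j = l))"
      and Q: "Q = c \<cdot>\<^sub>m 1\<^sub>m n" and sym: "transpose_mat M = M"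
      and comm: "\<forall>a\<in>elements_mat M. \<forall>b\<in>elements_mat M. commutator a b = 0"
    have "symmetric_relations n c m y q"
      unfolding symmetric_relations_def
    proof (intro conjI allI impI)
      show "c * x = x * c" for x using c by blast
      show "q p j = (if p = j then c else 0)" if "p < n" "j < n" for p j
        using that by (simp add: q_def Q)
      show "m p j = m j p" if "p < n" "j < n" for p j
        unfolding m_def using that dims(1) by (metis sym carrier_matD index_transpose_mat(1))
      show "m p a * m r b = m r b * m p a" if "p < n" "r < n" "a < n" "b < n" for p r a b
        using comm entry(1)[OF that(1,3)] entry(1)[OF that(2,4)] by (simp add: commutator_def)
      show "y l j * m r p = m r p * y l j
          + ((if r = j then if l = p then c else 0 else 0) + (if r = l then if p = j then c else 0 else 0))"
        if "l < n" "j < n" "r < n" "p < n" for l j r p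
      proof -
        have "m r p * y l j - y l j * m r p
            = - c * (of_bool (p = l) * of_bool (r = j) + of_bool (r = l) * of_bool (p = j))"
          using rel that by (simp add: commutator_def m_def y_def)
        hence "y l j * m r p = m r p * y l j
            + c * (of_bool (p = l) * of_bool (r = j) + of_bool (r = l) * of_bool (p = j))"
          by (simp add: algebra_simps)
        thus ?thesis by (auto simp: distrib_left)
      qed
    qed
    thus ?thesis by blast
  qed
  have cc_C: "cx_conj (C p j) = (\<Sum>a<n. ?cc m p a * ?cc y a j) + of_nat (n - Suc j) * ?cc q p j" for p j
    by (simp add: C_def cx.expand sum_negf sum_subtractf sum.distrib)
  have conj_C: "cx_conj \<beta> * C p j = C p j * cx_conj \<beta>"
    if "\<beta> \<in> elements_mat M \<union> elements_mat Y \<union> elements_mat Q" "p < n" "j < n" for \<beta> p j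
    unfolding C_def using that entry by (intro commute_capelli_entry conj[symmetric]) auto
  have conj_C': "\<alpha> * ?cc C p j = ?cc C p j * \<alpha>"
    if "\<alpha> \<in> elements_mat M \<union> elements_mat Y \<union> elements_mat Q" "p < n" "j < n" for \<alpha> p j
    unfolding cc_C using that entry by (intro commute_capelli_entry conj) auto
  have CC: "C p j * ?cc C r l = ?cc C r l * C p j" if "p < n" "r < n" "j < n" "l < n" for p r j l
    unfolding cc_C using that entry by (intro commute_capelli_entry conj_C[symmetric]) auto
  let ?A = "map_mat cx_of (decomplexify M) * map_mat cx_of (decomplexify Y)
            + map_mat cx_of (decomplexify Q) * map_mat (cx_scalar scale) (correction_mat n)"
  have dec_dims: "decomplexify M \<in> carrier_mat (2 * n) (2 * n)"
    "decomplexify Y \<in> carrier_mat (2 * n) (2 * n)" "decomplexify Q \<in> carrier_mat (2 * n) (2 * n)"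
    "(correction_mat n :: 'k cx mat) \<in> carrier_mat (2 * n) (2 * n)"
    using dims by (simp_all add: decomplexify_def correction_mat_def)
  have A_entry: "?A $$ (r, s) =
      (\<Sum>t<2 * n. cx_of (decomplexify M $$ (r, t)) * cx_of (decomplexify Y $$ (t, s)))
      + (\<Sum>t<2 * n. cx_of (decomplexify Q $$ (r, t)) * cx_scalar scale (correction_mat n $$ (t, s)))"
    if "r < 2 * n" "s < 2 * n" for r s
    using that dec_dims by (simp add: scalar_prod_def atLeast0LessThan)
  have T_diag: "scale (of_nat n - of_nat (Suc j) + 1 / 4) 1 = of_nat (n - Suc j) + hf * hf"
    "scale (of_nat n - of_nat (Suc j) - 1 / 4) 1 = of_nat (n - Suc j) - hf * hf"
    "scale (1 / 4) 1 = hf * hf" if "j < n" for j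
  proof -
    have "(1 / 4 :: 'k) = 1 / 2 * (1 / 2)" by simp
    hence q: "scale (1 / 4) 1 = hf * hf" unfolding hf_def by (simp only: scalar_mult)
    have "of_nat n - of_nat (Suc j) = (of_nat (n - Suc j) :: 'k)" using that by (simp add: of_nat_diff)
    thus "scale (of_nat n - of_nat (Suc j) + 1 / 4) 1 = of_nat (n - Suc j) + hf * hf"
      "scale (of_nat n - of_nat (Suc j) - 1 / 4) 1 = of_nat (n - Suc j) - hf * hf"
      by (simp_all only: scale_left_distrib scale_left_diff_distrib scalar_of_nat q)
    show "scale (1 / 4) 1 = hf * hf" by (rule q)
  qed
  have dec_entries: "decomplexify N $$ (r, 2 * a) = (if even r then re (N $$ (r div 2, a)) else - im (N $$ (r div 2, a)))"
    "decomplexify N $$ (r, Suc (2 * a)) = (if even r then im (N $$ (r div 2, a)) else re (N $$ (r div 2, a)))"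
    if "N \<in> carrier_mat n n" "r < 2 * n" "a < n" for N :: "'a cx mat" and r a
    using that by (simp_all add: decomplexify_index[OF that(1)] Let_def)
  have T_entries: "cx_scalar scale (correction_mat n $$ (2 * j, 2 * j)) = Cx (of_nat (n - Suc j) + hf * hf) 0"
    "cx_scalar scale (correction_mat n $$ (Suc (2 * j), 2 * j)) = Cx 0 (hf * hf)"
    "cx_scalar scale (correction_mat n $$ (2 * j, Suc (2 * j))) = Cx 0 (hf * hf)"
    "cx_scalar scale (correction_mat n $$ (Suc (2 * j), Suc (2 * j))) = Cx (of_nat (n - Suc j) - hf * hf) 0"
    if "j < n" for j
    using that by (simp_all add: correction_mat_def cx_scalar_def T_diag[OF that] del: of_nat_Suc of_nat_diff)
  have T_zero: "cx_scalar scale (correction_mat n $$ (t, s)) = 0"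
    if "t < 2 * n" "s < 2 * n" "t div 2 \<noteq> s div 2" for t s
    using that by (simp add: correction_mat_def cx_scalar_def cx.expand)
  have A_split: "?A $$ (r, s) =
      (\<Sum>a<n. cx_of (decomplexify M $$ (r, 2 * a)) * cx_of (decomplexify Y $$ (2 * a, s))
        + cx_of (decomplexify M $$ (r, Suc (2 * a))) * cx_of (decomplexify Y $$ (Suc (2 * a), s)))
      + (cx_of (decomplexify Q $$ (r, 2 * (s div 2))) * cx_scalar scale (correction_mat n $$ (2 * (s div 2), s))
        + cx_of (decomplexify Q $$ (r, Suc (2 * (s div 2)))) * cx_scalar scale (correction_mat n $$ (Suc (2 * (s div 2)), s)))"
    if rs: "r < 2 * n" "s < 2 * n" for r s
  proof -
    have "(\<Sum>t<2 * n. cx_of (decomplexify Q $$ (r, t)) * cx_scalar scale (correction_mat n $$ (t, s)))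
        = cx_of (decomplexify Q $$ (r, 2 * (s div 2))) * cx_scalar scale (correction_mat n $$ (2 * (s div 2), s))
        + cx_of (decomplexify Q $$ (r, Suc (2 * (s div 2)))) * cx_scalar scale (correction_mat n $$ (Suc (2 * (s div 2)), s))"
      by (rule sum_block_diagonal) (use rs in \<open>simp_all add: T_zero\<close>)
    thus ?thesis unfolding A_entry[OF rs] sum_pairs by (rule arg_cong)
  qed
  have quarter: "x * (of_nat k + hf * hf) = of_nat k * x + hf * (hf * x)"
    "x * (of_nat k - hf * hf) = of_nat k * x - hf * (hf * x)" "x * (hf * hf) = hf * (hf * x)" for x :: 'a and k
  proof -
    show q: "x * (hf * hf) = hf * (hf * x)" by (metis hf_central mult.assoc)
    show "x * (of_nat k + hf * hf) = of_nat k * x + hf * (hf * x)"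
      "x * (of_nat k - hf * hf) = of_nat k * x - hf * (hf * x)"
      by (simp_all only: distrib_left right_diff_distrib q mult_of_nat_commute)
  qed
  \<comment> \<open>The diagonal of the correction matrix without the quarters is absorbed into \<open>C\<close>.\<close>
  have A_even: "?A $$ (r, 2 * j) = (if even r
      then Cx (re (C (r div 2) j) + hf * (hf * re (q (r div 2) j))) (hf * (hf * im (q (r div 2) j)))
      else Cx (- im (C (r div 2) j) - hf * (hf * im (q (r div 2) j))) (hf * (hf * re (q (r div 2) j))))"
    and A_odd: "?A $$ (r, Suc (2 * j)) = (if even r
      then Cx (im (C (r div 2) j) - hf * (hf * im (q (r div 2) j))) (hf * (hf * re (q (r div 2) j)))
      else Cx (re (C (r div 2) j) - hf * (hf * re (q (r div 2) j))) (- (hf * (hf * im (q (r div 2) j)))))"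
    if r: "r < 2 * n" and j: "j < n" for r j
  proof -
    have s: "2 * j < 2 * n" "Suc (2 * j) < 2 * n" using j by auto
    note entries = dec_entries[OF dims(1) r] dec_entries[OF dims(2)] dec_entries[OF dims(3) r j] T_entries[OF j]
    show "?A $$ (r, 2 * j) = (if even r
      then Cx (re (C (r div 2) j) + hf * (hf * re (q (r div 2) j))) (hf * (hf * im (q (r div 2) j)))
      else Cx (- im (C (r div 2) j) - hf * (hf * im (q (r div 2) j))) (hf * (hf * re (q (r div 2) j))))"
      unfolding A_split[OF r s(1)] C_def m_def y_def q_def
      by (simp add: entries j cx.expand quarter sum_negf sum_subtractf sum.distrib del: of_nat_diff)
    show "?A $$ (r, Suc (2 * j)) = (if even r
      then Cx (im (C (r div 2) j) - hf * (hf * im (q (r div 2) j))) (hf * (hf * re (q (r div 2) j)))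
      else Cx (re (C (r div 2) j) - hf * (hf * re (q (r div 2) j))) (- (hf * (hf * im (q (r div 2) j)))))"
      unfolding A_split[OF r s(2)] C_def m_def y_def q_def
      by (simp add: entries j cx.expand quarter sum_negf sum_subtractf sum.distrib del: of_nat_diff)
  qed
  have "det_col ?A = column_det (2 * n) (\<lambda>r s. ?A $$ (r, s))"
    by (rule det_col_eq_column_det) (use dec_dims in simp)
  also have "\<dots> = column_det n C * column_det n (?cc C)"
  proof (rule column_det_doubled[where Q = q and i = i and h = h])
    show "q p j * ?cc C r l = ?cc C r l * q p j" if "p < n" "r < n" "j < n" "l < n" for p r j l
      using that entry by (intro conj_C') auto
    show "grassmann.vec scal n g (\<lambda>p. C p j + h * q p j) * grassmann.vec scal n g (\<lambda>p. C p j - h * q p j) = 0"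
      if "grassmann scal n g" "j < n" for g :: "nat \<Rightarrow> 'a cx fock_op" and j
      by (rule grassmann.capelli_shift_product[OF that(1) rel _ that(2) h]) (simp_all add: C_def yy that(2))
  next
    fix r j assume rj: "r < 2 * n" "j < n"
    show "?A $$ (r, 2 * j) = (if even r then h * (?cc C (r div 2) j + (C (r div 2) j + h * q (r div 2) j))
       else i * (h * (C (r div 2) j + h * q (r div 2) j - ?cc C (r div 2) j)))"
      unfolding A_even[OF rj] by (simp add: cx.expand h_def i_def distrib_left right_diff_distrib hf_double algebra_simps)
    show "?A $$ (r, Suc (2 * j)) = (if even r
       then i * (h * (?cc C (r div 2) j - (C (r div 2) j - h * q (r div 2) j)))
       else h * (?cc C (r div 2) j + (C (r div 2) j - h * q (r div 2) j)))"
      unfolding A_odd[OF rj] by (simp add: cx.expand h_def i_def distrib_left right_diff_distrib hf_double algebra_simps)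
  qed (fact h i CC)+
  also have "column_det n (?cc C) = cx_conj (column_det n C)"
    by (rule column_det_cx_conj[symmetric])
  also have "column_det n C = column_det n m * column_det n y"
    by (rule top_coefficient_eq[where N = n])
      (rule grassmann.capelli_column_det[OF grassmann_scal_gen rel], rule C_def)
  also have "column_det n m * column_det n y * cx_conj (column_det n m * column_det n y)
      = (column_det n m * cx_conj (column_det n m)) * (column_det n y * cx_conj (column_det n y))"
    unfolding cx_conj_mult
  proof (rule mult_swap_middle)
    show "column_det n y * cx_conj (column_det n m) = cx_conj (column_det n m) * column_det n y"
      unfolding column_det_cx_conj
      by (intro commute_column_det commute_column_det[symmetric] conj) (use entry in auto)
  qed
  also have "column_det n m * cx_conj (column_det n m) = cx_of (det_col (decomplexify M))"
  proof (unfold m_def, rule column_det_decomplexify[OF dims(1) hf2 hf_central, symmetric], fold m_def)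
    fix p r j l assume "p < n" "r < n" "j < n" "l < n"
    show "m p j * m r j = m r j * m p j"
      using rel
    proof (elim disjE exE)
      assume "manin_relations n m y q"
      thus ?thesis by (rule manin_relations_column) fact+
    next
      fix c assume "symmetric_relations n c m y q"
      thus ?thesis by (rule symmetric_relations_commute) fact+
    qed
    show "m p j * cx_conj (m r l) = cx_conj (m r l) * m p j"
      by (intro conj UnI1 entry(1)) fact+
  qed
  also have "column_det n y * cx_conj (column_det n y) = cx_of (det_col (decomplexify Y))"
  proof (unfold y_def, rule column_det_decomplexify[OF dims(2) hf2 hf_central, symmetric], fold y_def)
    fix p r j l assume "p < n" "r < n" "j < n" "l < n"
    show "y p j * y r j = y r j * y p j" by (rule yy) fact+
    show "y p j * cx_conj (y r l) = cx_conj (y r l) * y p j"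
      by (intro conj UnI1[OF UnI2] entry(2)) fact+
  qed
  finally show ?thesis .
qed

end
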